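(* Let $q:\mathbb{R}\to(0,\infty)$ be a fixed positive polynomial of degree $2m$, $m\in\mathbb{N}$, with associated weights $\rho_\kappa=q^{-\kappa/(2m)}$, $\kappa\in\mathbb{R}$, and let $\gamma>0$ be fixed. For any $\upsilon\in\mathbb{R}$, $1<p<\infty$ and $\alpha\in\mathbb{N}$, there is a constant $C_{\upsilon,\alpha,p}>0$ such that $$\big|I_{\rho_\upsilon}(f)-Q_{\rho_\upsilon,n}(f)\big|\le C_{\upsilon,\alpha,p}\,n^{-\alpha}\,\|f\|_{\widetilde W^{\alpha,p}_{\rho_{p(\upsilon-2-2\alpha)+2}}(\mathbb{R})}$$ for all $f\in\widetilde W^{\alpha,p}_{\rho_{p(\upsilon-2-2\alpha)+2}}(\mathbb{R})$ and all $n\in\mathbb{N}$; that is, $C_{\upsilon,\alpha,p}$ is independent of $f$ and $n$ (it may depend on $q$ and $\gamma$).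
   Context: $\mathbb{N}=\{1,2,\dots\}$, $\mathbb{N}_0=\mathbb{N}\cup\{0\}$. Functions are complex-valued; polynomials have real coefficients. Weights: for the fixed strictly positive polynomial $q$ of degree $2m$ on $\mathbb{R}$, $\rho_\kappa(x)=(q(x))^{-\kappa/(2m)}$ for $x\in\mathbb{R}$ and $\kappa\in\mathbb{R}$. $L^p_{\rho_\kappa}(\mathbb{R})$ is the space of Lebesgue measurable functions with finite norm $\|f\|_{L^p_{\rho_\kappa}(\mathbb{R})}=\big(\int_{\mathbb{R}}|f(x)|^p\rho_\kappa(x)\,dx\big)^{1/p}$. Variable-weight Sobolev space: for $\alpha\in\mathbb{N}_0$, $1\le p<\infty$, $\kappa\in\mathbb{R}$, $\widetilde W^{\alpha,p}_{\rho_\kappa}(\mathbb{R})$ is the set of $f\in L^p_{\rho_{\kappa+\alpha p}}(\mathbb{R})$ with weak derivatives $f^{(\tau)}$ up to order $\alpha$ such that $$\|f\|_{\widetilde W^{\alpha,p}_{\rho_\kappa}(\mathbb{R})}=\Big(\sum_{\tau=0}^{\alpha}\int_{\mathbb{R}}|f^{(\tau)}(x)|^p\,\rho_{\kappa+p(\alpha-\tau)}(x)\,dx\Big)^{1/p}<\infty.$$ Change of variables: for fixed $\gamma>0$, $\phi(\theta)=-\gamma\cot(\theta/2)$, $\theta\in(0,2\pi)$, so $\phi'(\theta)=\gamma/(2\sin^2(\theta/2))$. Integral and Möbius-transformed trapezoidal rule: $$I_{\rho_\upsilon}(f)=\int_{\mathbb{R}}f(x)\rho_\upsilon(x)\,dx,\qquad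 Q_{\rho_\upsilon,n}(f)=\frac{2\pi}{n}\sum_{j=1}^n f(\phi(\theta_j))\,\rho_\upsilon(\phi(\theta_j))\,\phi'(\theta_j),\qquad \theta_j=\frac{2\pi j}{n}-\frac{\pi}{n}.$$ When $f$ is a Sobolev function (locally in $W^{\alpha,p}$ with $\alpha>1/p$), its continuous representative is used to evaluate $Q_{\rho_\upsilon,n}(f)$. *)

theory Defs
  imports "HOL-Analysis.Analysis" "HOL-Computational_Algebra.Polynomial"
begin

definition rho :: "real poly \<Rightarrow> nat \<Rightarrow> real \<Rightarrow> real \<Rightarrow> real" where
  "rho q m \<kappa> x = poly q x powr (- \<kappa> / (2 * real m))"

text \<open>Function spaces are modelled by functions rather than by classes modulo null sets.\<close>

definition weighted_Lp :: "real \<Rightarrow> (real \<Rightarrow> real) \<Rightarrow> (real \<Rightarrow> complex) set" where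
  "weighted_Lp p w = {f \<in> borel_measurable lebesgue.
     integrable lebesgue (\<lambda>x. cmod (f x) powr p * w x)}"

definition locally_integrable :: "(real \<Rightarrow> complex) \<Rightarrow> bool" where
  "locally_integrable f \<longleftrightarrow> (\<forall>K. compact K \<longrightarrow> set_integrable lebesgue K f)"

text \<open>Test functions are taken real-valued; by linearity this gives the same weak derivatives as
  complex-valued test functions.\<close>

definition test_function :: "(real \<Rightarrow> real) \<Rightarrow> bool" where
  "test_function \<psi> \<longleftrightarrow>
     (\<forall>k x. (deriv ^^ k) \<psi> field_differentiable (at x)) \<and> compact (closure {x. \<psi> x \<noteq> 0})"

definition has_weak_deriv :: "nat \<Rightarrow> (real \<Rightarrow> complex) \<Rightarrow> (real \<Rightarrow> complex) \<Rightarrow> bool" where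
  "has_weak_deriv \<tau> f g \<longleftrightarrow> locally_integrable f \<and> locally_integrable g \<and>
     (\<forall>\<psi>. test_function \<psi> \<longrightarrow>
        (LINT x|lebesgue. (deriv ^^ \<tau>) \<psi> x *\<^sub>R f x) =
        (- 1) ^ \<tau> * (LINT x|lebesgue. \<psi> x *\<^sub>R g x))"

text \<open>A weak derivative is determined only up to a null set; the choice of a representative does
  not affect the integrals below.\<close>

definition weak_deriv :: "nat \<Rightarrow> (real \<Rightarrow> complex) \<Rightarrow> real \<Rightarrow> complex" where
  "weak_deriv \<tau> f = (SOME g. has_weak_deriv \<tau> f g)"

text \<open>Finiteness of the norm is expressed by integrability of each of its nonnegative integrands,
  since the Bochner integral of a non-integrable function is 0.\<close>

definition var_sobolev ::
  "real poly \<Rightarrow> nat \<Rightarrow> nat \<Rightarrow> real \<Rightarrow> real \<Rightarrow> (real \<Rightarrow> complex) set" where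
  "var_sobolev q m \<alpha> p \<kappa> = {f \<in> weighted_Lp p (rho q m (\<kappa> + real \<alpha> * p)).
     \<forall>\<tau>\<le>\<alpha>. (\<exists>g. has_weak_deriv \<tau> f g) \<and>
       integrable lebesgue
         (\<lambda>x. cmod (weak_deriv \<tau> f x) powr p * rho q m (\<kappa> + p * (real \<alpha> - real \<tau>)) x)}"

definition var_sobolev_norm ::
  "real poly \<Rightarrow> nat \<Rightarrow> nat \<Rightarrow> real \<Rightarrow> real \<Rightarrow> (real \<Rightarrow> complex) \<Rightarrow> real" where
  "var_sobolev_norm q m \<alpha> p \<kappa> f =
     (\<Sum>\<tau>=0..\<alpha>. LINT x|lebesgue.
        cmod (weak_deriv \<tau> f x) powr p * rho q m (\<kappa> + p * (real \<alpha> - real \<tau>)) x) powr (1 / p)"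

text \<open>Two continuous functions that agree almost everywhere are equal, so the representative is
  unique whenever it exists.\<close>

definition continuous_rep :: "(real \<Rightarrow> complex) \<Rightarrow> real \<Rightarrow> complex" where
  "continuous_rep f = (THE g. continuous_on UNIV g \<and> (AE x in lebesgue. g x = f x))"

definition phi :: "real \<Rightarrow> real \<Rightarrow> real" where
  "phi \<gamma> \<theta> = - \<gamma> * cot (\<theta> / 2)"

definition node :: "nat \<Rightarrow> nat \<Rightarrow> real" where
  "node n j = 2 * pi * real j / real n - pi / real n"

definition weighted_integral :: "real poly \<Rightarrow> nat \<Rightarrow> real \<Rightarrow> (real \<Rightarrow> complex) \<Rightarrow> complex" where
  "weighted_integral q m \<upsilon> f = (LINT x|lebesgue. f x * of_real (rho q m \<upsilon> x))"

definition moebius_trapezoidal ::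
  "real poly \<Rightarrow> nat \<Rightarrow> real \<Rightarrow> real \<Rightarrow> nat \<Rightarrow> (real \<Rightarrow> complex) \<Rightarrow> complex" where
  "moebius_trapezoidal q m \<gamma> \<upsilon> n f =
     of_real (2 * pi / real n) *
     (\<Sum>j=1..n. f (phi \<gamma> (node n j)) *
        of_real (rho q m \<upsilon> (phi \<gamma> (node n j)) * deriv (phi \<gamma>) (node n j)))"

end

(* Substituting x = phi(theta) turns the rule into the midpoint rule on (0, 2 pi) for
   g(theta) = f(x) rho(x) phi'(theta). A Sobolev function has a representative whose derivatives up to
   order alpha - 1 are absolutely continuous, so g^(tau) = (phi' d/dx)^tau (f rho phi') is too for
   tau < alpha. The growing weights on low order derivatives force these to vanish at both ends of
   (0, 2 pi): g is a periodic Sobolev function. Hence the error is, up to sign, the integral of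
   g^(alpha) against n^(-alpha) times a bounded periodic Bernoulli-type kernel, and g^(alpha) is
   controlled in L^p by the weighted norm of f. The analysis is done on the x line, where theta is
   the function angle and d/dtheta is jac d/dx. *)

theory Submission
  imports Defs
begin

section \<open>Absolutely continuous functions\<close>

text \<open>The exponent of the space is fixed by a growth count. Each application of
  \<open>jac d/dx\<close> differentiates either a coefficient or f, so in the \<tau>-th
  \<theta>-derivative the coefficient of the \<sigma>-th derivative of f grows at most like (1 +
  |x|)^(2 - \<upsilon> + \<tau> + \<sigma>). The p-th power of this is (1 + |x|)^(2 - p (\<alpha> -
  \<tau>)) times the growth of the weight on that derivative, whatever \<sigma> is. For \<tau> =
  \<alpha> the remaining square is cancelled exactly by d\<theta> = dx / jac. For \<tau> < \<alpha>
  at most one factor 1 + |x| remains; since 1/x is not integrable at infinity, this still excludes a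
  nonzero limit. The last derivative may be rough and is known only up to null sets. Integration by
  parts is therefore built on primitives of locally integrable functions instead of pointwise
  derivatives. With h = 2 pi / n, the kernel of index k is h^(k+1) times one fixed bounded function,
  evaluated at \<open>angle x / h + 1 / 2\<close>. This scaling produces the power of n and keeps
  all constants independent of n.\<close>

lemma sigma_finite_lebesgue: "sigma_finite_measure (lebesgue :: 'a::euclidean_space measure)"
proof
  have "x \<in> (\<Union>n. ball 0 (real n))" for x :: 'a
    using reals_Archimedean2[of "norm x"] by simp
  then have "(\<Union>n. ball (0::'a) (real n)) = UNIV"
    by blast
  with emeasure_lborel_ball_finite
  have "countable (range (\<lambda>n. ball (0::'a) (real n))) \<and> range (\<lambda>n. ball (0::'a) (real n)) \<subseteq> sets lebesgue \<and>
      \<Union> (range (\<lambda>n. ball (0::'a) (real n))) = space lebesgue \<and>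
      (\<forall>a\<in>range (\<lambda>n. ball (0::'a) (real n)). emeasure lebesgue a \<noteq> \<infinity>)"
    by (auto simp: less_top[symmetric])
  then show "\<exists>A. countable A \<and> A \<subseteq> sets lebesgue \<and> \<Union>A = space (lebesgue :: 'a measure) \<and> (\<forall>a\<in>A. emeasure lebesgue a \<noteq> \<infinity>)"
    by (rule exI)
qed

text \<open>Absolute continuity is encoded as being a primitive of a locally integrable function.
  This form ignores changes of \<open>v\<close> on null sets, as weak derivatives require, and it
  gives the product rule by Fubini.\<close>

definition has_ac_deriv :: "(real \<Rightarrow> 'a::euclidean_space) \<Rightarrow> (real \<Rightarrow> 'a) \<Rightarrow> bool" where
  "has_ac_deriv u v \<longleftrightarrow>
     (\<forall>a b. a \<le> b \<longrightarrow> v absolutely_integrable_on {a..b} \<and> integral {a..b} v = u b - u a)"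

lemma has_ac_derivD:
  assumes "has_ac_deriv u v"
  shows "v absolutely_integrable_on {a..b}" "a \<le> b \<Longrightarrow> integral {a..b} v = u b - u a"
  using assms unfolding has_ac_deriv_def by (cases "a \<le> b"; force)+

lemma has_ac_deriv_continuous:
  assumes "has_ac_deriv u v"
  shows "continuous_on A u"
proof -
  have "isCont u x" for x
  proof -
    have "continuous_on {x-1..x+1} (\<lambda>y. u (x-1) + integral {x-1..y} v)"
      by (intro continuous_intros indefinite_integral_continuous_1 set_lebesgue_integral_eq_integral(1)
            has_ac_derivD(1)[OF assms])
    then have "continuous_on {x-1..x+1} u"
      by (rule continuous_on_eq) (simp add: has_ac_derivD(2)[OF assms])
    then show ?thesis
      by (rule continuous_on_interior) auto
  qed
  then show ?thesis
    by (simp add: continuous_at_imp_continuous_on)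
qed

text \<open>An integral over an interval with reversed endpoints is 0, so the difference of the two
  terms is the oriented integral from 0 to \<open>x\<close>.\<close>

lemma has_ac_deriv_indefinite:
  assumes "\<And>a b. v absolutely_integrable_on {a..b}"
  shows "has_ac_deriv (\<lambda>x. integral {0..x} v - integral {x..0} v) v"
  unfolding has_ac_deriv_def
proof (intro allI impI conjI assms)
  fix a b :: real assume ab: "a \<le> b"
  have int: "v integrable_on {c..d}" for c d
    using assms by (rule set_lebesgue_integral_eq_integral(1))
  have comb: "integral {c..d} v + integral {d..e} v = integral {c..e} v" if "c \<le> d" "d \<le> e" for c d e
    using Henstock_Kurzweil_Integration.integral_combine[OF that int] .
  have deg: "integral {c..d} v = 0" if "d \<le> c" for c d
    using that by (cases "c = d") auto
  show "integral {a..b} v = integral {0..b} v - integral {b..0} v - (integral {0..a} v - integral {a..0} v)"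
  proof -
    consider "0 \<le> a" | "a \<le> 0" "0 \<le> b" | "b \<le> 0" by linarith
    then show ?thesis
    proof cases
      case 1
      then show ?thesis using comb[of 0 a b] ab deg[of 0 a] deg[of 0 b] by (simp add: algebra_simps)
    next
      case 2
      then show ?thesis using comb[of a 0 b] deg[of a 0] deg[of 0 b] by (simp add: algebra_simps)
    next
      case 3
      then show ?thesis using comb[of a b 0] ab deg[of a 0] deg[of b 0] by (simp add: algebra_simps)
    qed
  qed
qed

text \<open>The exceptional set \<open>S\<close> is there for the first continuous kernel, whose
  derivative jumps at finitely many points of the line.\<close>

lemma has_ac_deriv_FTC:
  fixes g :: "real \<Rightarrow> 'a::euclidean_space"
  assumes "finite S" "continuous_on UNIV g"
    and "\<And>x. x \<notin> S \<Longrightarrow> (g has_vector_derivative g' x) (at x)"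
    and "\<And>a b. g' absolutely_integrable_on {a..b}"
  shows "has_ac_deriv g g'"
  unfolding has_ac_deriv_def
proof (intro allI impI conjI assms)
  fix a b :: real assume "a \<le> b"
  then have "(g' has_integral (g b - g a)) {a..b}"
    by (intro fundamental_theorem_of_calculus_strong[OF \<open>finite S\<close>])
       (auto intro: assms(3) continuous_on_subset[OF assms(2)])
  then show "integral {a..b} g' = g b - g a" by (rule integral_unique)
qed

lemma has_ac_deriv_C1:
  fixes g :: "real \<Rightarrow> 'a::euclidean_space"
  assumes "\<And>x. (g has_vector_derivative g' x) (at x)" "continuous_on UNIV g'"
  shows "has_ac_deriv g g'"
proof (rule has_ac_deriv_FTC[where S = "{}"])
  show "continuous_on UNIV g"
    using assms(1) by (meson continuous_at_imp_continuous_on has_vector_derivative_continuous)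
  show "g' absolutely_integrable_on {a..b}" for a b
    by (rule absolutely_integrable_continuous_real) (rule continuous_on_subset[OF assms(2)], simp)
qed (use assms in auto)

text \<open>Allows a weak derivative to be exchanged for its own absolutely continuous
  representative, so that representatives of successive orders form a chain.\<close>

lemma has_ac_deriv_cong_AE:
  assumes "has_ac_deriv u v" "AE x in lebesgue. v x = w x"
  shows "has_ac_deriv u w"
  unfolding has_ac_deriv_def
proof (intro allI impI conjI)
  fix a b :: real assume ab: "a \<le> b"
  have "AE x in lebesgue. indicator {a..b} x *\<^sub>R v x = indicator {a..b} x *\<^sub>R w x"
    using assms(2) by eventually_elim simp
  note eq = this
  have v: "integrable lebesgue (\<lambda>x. indicator {a..b} x *\<^sub>R v x)"
    using has_ac_derivD(1)[OF assms(1)] by (simp add: set_integrable_def)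
  have meas: "(\<lambda>x. indicator {a..b} x *\<^sub>R w x) \<in> borel_measurable lebesgue"
    using borel_measurable_AE[OF borel_measurable_integrable[OF v] eq] .
  have *: "integrable lebesgue (\<lambda>x. indicator {a..b} x *\<^sub>R w x)"
    using integrable_cong_AE[OF borel_measurable_integrable[OF v] meas eq] v by blast
  have **: "integral\<^sup>L lebesgue (\<lambda>x. indicator {a..b} x *\<^sub>R v x) = integral\<^sup>L lebesgue (\<lambda>x. indicator {a..b} x *\<^sub>R w x)"
    by (rule integral_cong_AE[OF borel_measurable_integrable[OF v] meas eq])
  from * show w: "w absolutely_integrable_on {a..b}" by (simp add: set_integrable_def)
  show "integral {a..b} w = u b - u a"
    using ** set_lebesgue_integral_eq_integral(2)[OF w]
      set_lebesgue_integral_eq_integral(2)[OF has_ac_derivD(1)[OF assms(1)], of a b]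
      has_ac_derivD(2)[OF assms(1) ab]
    by (simp add: set_lebesgue_integral_def)
qed

lemma has_ac_deriv_sum:
  assumes "finite I" "\<And>i. i \<in> I \<Longrightarrow> has_ac_deriv (u i) (v i)"
  shows "has_ac_deriv (\<lambda>x. \<Sum>i\<in>I. u i x) (\<lambda>x. \<Sum>i\<in>I. v i x)"
  unfolding has_ac_deriv_def
proof (intro allI impI conjI)
  fix a b :: real assume "a \<le> b"
  note v = has_ac_derivD[OF assms(2)]
  show "(\<lambda>x. \<Sum>i\<in>I. v i x) absolutely_integrable_on {a..b}"
    by (rule absolutely_integrable_sum[OF assms(1)]) (rule v)
  have "integral {a..b} (\<lambda>x. \<Sum>i\<in>I. v i x) = (\<Sum>i\<in>I. integral {a..b} (v i))"
    by (rule integral_sum[OF assms(1)]) (rule set_lebesgue_integral_eq_integral(1)[OF v(1)])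
  then show "integral {a..b} (\<lambda>x. \<Sum>i\<in>I. v i x) = (\<Sum>i\<in>I. u i b) - (\<Sum>i\<in>I. u i a)"
    using v(2)[OF _ \<open>a \<le> b\<close>] by (simp add: sum_subtractf)
qed

lemma absolutely_integrable_continuous_scaleR:
  fixes v :: "real \<Rightarrow> 'a::euclidean_space"
  assumes "continuous_on {a..b} g" "v absolutely_integrable_on {a..b}"
  shows "(\<lambda>x. g x *\<^sub>R v x) absolutely_integrable_on {a..b}"
proof (rule absolutely_integrable_bounded_measurable_product[of scaleR])
  show "bilinear (scaleR :: real \<Rightarrow> 'a \<Rightarrow> 'a)"
    by (simp add: bilinear_conv_bounded_bilinear bounded_bilinear_scaleR)
  show "g \<in> borel_measurable (lebesgue_on {a..b})"
    by (rule continuous_imp_measurable_on_sets_lebesgue[OF assms(1)]) auto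
  show "bounded (g ` {a..b})"
    by (intro compact_imp_bounded compact_continuous_image assms) auto
qed (use assms in auto)

text \<open>Integration by parts is Fubini on the triangle a <= s <= t <= b for the function
  \<open>h t *\<^sub>R v s\<close>. Integrating in s first gives the integral of h (u - u a),
  integrating in t first that of (g b - g) v; equating and expanding them gives the boundary terms.
  The completed measure enters through \<open>sigma_finite_lebesgue\<close>.\<close>

lemma has_ac_deriv_scaleR:
  fixes u v :: "real \<Rightarrow> 'a::euclidean_space"
  assumes uv: "has_ac_deriv u v" and gh: "has_ac_deriv g h"
  shows "has_ac_deriv (\<lambda>x. g x *\<^sub>R u x) (\<lambda>x. g x *\<^sub>R v x + h x *\<^sub>R u x)"
  unfolding has_ac_deriv_def
proof (intro allI impI conjI)
  fix a b :: real assume ab: "a \<le> b"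
  have hu: "(\<lambda>x. h x *\<^sub>R u x) absolutely_integrable_on {a..b}"
  proof (rule absolutely_integrable_bounded_measurable_product[of "\<lambda>y r. r *\<^sub>R y"])
    show "bilinear (\<lambda>(y::'a) r. r *\<^sub>R y)"
      by (simp add: bilinear_conv_bounded_bilinear bounded_bilinear.flip[OF bounded_bilinear_scaleR])
    have c: "continuous_on {a..b} u" by (rule has_ac_deriv_continuous[OF uv])
    then show "u \<in> borel_measurable (lebesgue_on {a..b})"
      by (rule continuous_imp_measurable_on_sets_lebesgue) auto
    show "bounded (u ` {a..b})"
      by (intro compact_imp_bounded compact_continuous_image c) auto
  qed (use has_ac_derivD(1)[OF gh] in auto)
  have gv: "(\<lambda>x. g x *\<^sub>R v x) absolutely_integrable_on {a..b}"
    by (intro absolutely_integrable_continuous_scaleR has_ac_deriv_continuous[OF gh] has_ac_derivD(1)[OF uv])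
  show "(\<lambda>x. g x *\<^sub>R v x + h x *\<^sub>R u x) absolutely_integrable_on {a..b}"
    using gv hu by (rule set_integral_add)
  define v' where "v' s = indicator {a..b} s *\<^sub>R v s" for s
  define h' where "h' s = indicator {a..b} s * h s" for s
  have v': "integrable lebesgue v'"
    using has_ac_derivD(1)[OF uv] by (simp add: set_integrable_def v'_def[abs_def])
  have h': "integrable lebesgue h'"
    using has_ac_derivD(1)[OF gh] by (simp add: set_integrable_def h'_def[abs_def])
  note [measurable] = borel_measurable_integrable[OF v'] borel_measurable_integrable[OF h']
  interpret pair_sigma_finite lebesgue "lebesgue :: real measure"
    by (intro pair_sigma_finite.intro sigma_finite_lebesgue)
  have [measurable]: "(\<lambda>x. x) \<in> lebesgue \<rightarrow>\<^sub>M (borel :: real measure)"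
    by (simp add: measurable_completion)
  \<comment> \<open>The cut-offs \<open>v'\<close> and \<open>h'\<close> confine the integrand to
    the square, and the condition \<open>s \<le> t\<close> to the triangle. It is dominated by the
    product of two integrable functions of one variable each.\<close>
  let ?F = "\<lambda>s t. if s \<le> t then h' t *\<^sub>R v' s else 0"
  have "integrable (lebesgue \<Otimes>\<^sub>M lebesgue) (\<lambda>(s,t). h' t *\<^sub>R v' s)"
  proof (rule Fubini_integrable)
    show "integrable lebesgue (\<lambda>x. LINT y|lebesgue. norm (case (x, y) of (s, t) \<Rightarrow> h' t *\<^sub>R v' s))"
      using v' h' by simp
    show "AE x in lebesgue. integrable lebesgue (\<lambda>y. case (x, y) of (s, t) \<Rightarrow> h' t *\<^sub>R v' s)"
      using h' by simp
  qed measurable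
  then have "integrable (lebesgue \<Otimes>\<^sub>M lebesgue) (\<lambda>(s,t). ?F s t)"
    by (rule Bochner_Integration.integrable_bound) (measurable, auto)
  then have "(LINT t|lebesgue. LINT s|lebesgue. ?F s t) = (LINT s|lebesgue. LINT t|lebesgue. ?F s t)"
    by (rule Fubini_integral)
  moreover have "(LINT s|lebesgue. ?F s t) = indicator {a..b} t *\<^sub>R h t *\<^sub>R (u t - u a)" for t
  proof (cases "t \<in> {a..b}")
    case True
    have "(LINT s|lebesgue. ?F s t) = (LINT s|lebesgue. h t *\<^sub>R (indicator {a..t} s *\<^sub>R v s))"
      using True by (intro Bochner_Integration.integral_cong) (auto simp: h'_def v'_def indicator_def)
    also have "\<dots> = h t *\<^sub>R (LINT s:{a..t}|lebesgue. v s)"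
      unfolding set_lebesgue_integral_def by (rule Bochner_Integration.integral_scaleR_right)
    finally show ?thesis
      using True by (simp add: set_lebesgue_integral_eq_integral(2) has_ac_derivD[OF uv])
  qed (simp add: h'_def cong: if_cong)
  moreover have "(LINT t|lebesgue. ?F s t) = indicator {a..b} s *\<^sub>R (g b - g s) *\<^sub>R v s" for s
  proof (cases "s \<in> {a..b}")
    case True
    have "(LINT t|lebesgue. ?F s t) = (LINT t|lebesgue. (indicator {s..b} t *\<^sub>R h t) *\<^sub>R v s)"
      using True by (intro Bochner_Integration.integral_cong) (auto simp: h'_def v'_def indicator_def)
    also have "\<dots> = (LINT t:{s..b}|lebesgue. h t) *\<^sub>R v s"
      using has_ac_derivD(1)[OF gh, of s b] unfolding set_lebesgue_integral_def set_integrable_def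
      by (intro integral_scaleR_left) auto
    finally show ?thesis
      using True by (simp add: set_lebesgue_integral_eq_integral(2) has_ac_derivD[OF gh])
  qed (simp add: v'_def cong: if_cong)
  ultimately have "(LINT t:{a..b}|lebesgue. h t *\<^sub>R (u t - u a)) = (LINT s:{a..b}|lebesgue. (g b - g s) *\<^sub>R v s)"
    unfolding set_lebesgue_integral_def by simp
  also have "(LINT t:{a..b}|lebesgue. h t *\<^sub>R (u t - u a)) =
      (LINT t:{a..b}|lebesgue. h t *\<^sub>R u t) - (LINT t:{a..b}|lebesgue. h t *\<^sub>R u a)"
    unfolding scaleR_diff_right
    by (rule set_integral_diff(2)[OF hu absolutely_integrable_scaleR_right[OF has_ac_derivD(1)[OF gh]]])
  also have "(LINT t:{a..b}|lebesgue. h t *\<^sub>R u a) = (LINT t:{a..b}|lebesgue. h t) *\<^sub>R u a"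
    using has_ac_derivD(1)[OF gh, of a b] unfolding set_lebesgue_integral_def set_integrable_def
    by (subst integral_scaleR_left[symmetric]) auto
  also have "(LINT s:{a..b}|lebesgue. (g b - g s) *\<^sub>R v s) =
      (LINT s:{a..b}|lebesgue. g b *\<^sub>R v s) - (LINT s:{a..b}|lebesgue. g s *\<^sub>R v s)"
    unfolding scaleR_diff_left
    by (rule set_integral_diff(2)[OF absolutely_integrable_scaleR_left[OF has_ac_derivD(1)[OF uv]] gv])
  finally have "integral {a..b} (\<lambda>t. h t *\<^sub>R u t) - (g b - g a) *\<^sub>R u a =
      g b *\<^sub>R (u b - u a) - integral {a..b} (\<lambda>s. g s *\<^sub>R v s)"
    by (simp add: set_lebesgue_integral_eq_integral(2)[OF hu] set_lebesgue_integral_eq_integral(2)[OF gv]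
      set_lebesgue_integral_eq_integral(2)[OF has_ac_derivD(1)[OF uv]] has_ac_derivD(2)[OF uv ab]
      set_lebesgue_integral_eq_integral(2)[OF has_ac_derivD(1)[OF gh]] has_ac_derivD(2)[OF gh ab]
      del: integral_scaleR_right)
  then show "integral {a..b} (\<lambda>x. g x *\<^sub>R v x + h x *\<^sub>R u x) = g b *\<^sub>R u b - g a *\<^sub>R u a"
    using set_lebesgue_integral_eq_integral(1)[OF hu] set_lebesgue_integral_eq_integral(1)[OF gv]
    by (simp add: Henstock_Kurzweil_Integration.integral_add algebra_simps)
qed

section \<open>Smooth test functions\<close>

text \<open>Finite orders make the closure properties inductive: differentiating once lowers the
  order by one, with the functions generalised.\<close>

definition times_differentiable :: "nat \<Rightarrow> (real \<Rightarrow> real) \<Rightarrow> bool" where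
  "times_differentiable n f \<longleftrightarrow> (\<forall>k<n. \<forall>x. (deriv ^^ k) f field_differentiable (at x))"

lemma times_differentiable_0 [simp]: "times_differentiable 0 f"
  by (simp add: times_differentiable_def)

lemma times_differentiable_Suc:
  "times_differentiable (Suc n) f \<longleftrightarrow>
     (\<forall>x. f field_differentiable (at x)) \<and> times_differentiable n (deriv f)"
  unfolding times_differentiable_def All_less_Suc2 by (simp add: funpow_swap1)

lemma times_differentiable_SucD: "times_differentiable (Suc n) f \<Longrightarrow> times_differentiable n f"
  by (simp add: times_differentiable_def)

lemma test_function_iff:
  "test_function \<psi> \<longleftrightarrow> (\<forall>n. times_differentiable n \<psi>) \<and> compact (closure {x. \<psi> x \<noteq> 0})"
  unfolding test_function_def times_differentiable_def by blast

lemma times_differentiable_closed: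
  assumes "f \<in> F" "\<And>f x. f \<in> F \<Longrightarrow> f field_differentiable (at x)" "\<And>f. f \<in> F \<Longrightarrow> deriv f \<in> F"
  shows "times_differentiable n f"
  using assms(1) by (induction n arbitrary: f) (auto simp: times_differentiable_Suc assms(2,3))

lemma times_differentiable_add:
  "times_differentiable n f \<Longrightarrow> times_differentiable n g \<Longrightarrow> times_differentiable n (\<lambda>x. f x + g x)"
proof (induction n arbitrary: f g)
  case (Suc n)
  then have "deriv (\<lambda>x. f x + g x) = (\<lambda>x. deriv f x + deriv g x)"
    by (intro ext deriv_add) (auto simp: times_differentiable_Suc)
  with Suc show ?case by (auto simp: times_differentiable_Suc intro: field_differentiable_add)
qed simp

lemma times_differentiable_mult:
  "times_differentiable n f \<Longrightarrow> times_differentiable n g \<Longrightarrow> times_differentiable n (\<lambda>x. f x * g x)"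
proof (induction n arbitrary: f g)
  case (Suc n)
  then have "deriv (\<lambda>x. f x * g x) = (\<lambda>x. f x * deriv g x + deriv f x * g x)"
    by (intro ext deriv_mult) (auto simp: times_differentiable_Suc)
  moreover have "times_differentiable n f" "times_differentiable n g"
    using Suc.prems times_differentiable_SucD by blast+
  ultimately show ?case
    using Suc by (auto simp: times_differentiable_Suc intro: field_differentiable_mult times_differentiable_add)
qed simp

lemma times_differentiable_const [simp]: "times_differentiable n (\<lambda>x. c)"
  by (rule times_differentiable_closed[where F = "range (\<lambda>c x. c)"]) auto

lemma times_differentiable_affine:
  "times_differentiable n f \<Longrightarrow> times_differentiable n (\<lambda>x. f (c * x + d))"
proof (induction n arbitrary: f)
  case (Suc n)
  have d: "((\<lambda>x. f (c * x + d)) has_field_derivative c * deriv f (c * x + d)) (at x)" for x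
  proof -
    have "(f has_field_derivative deriv f (c * x + d)) (at (c * x + d))"
      using Suc.prems by (simp add: times_differentiable_Suc field_differentiable_derivI)
    then show ?thesis
      by (rule DERIV_chain2[THEN DERIV_cong]) (auto intro!: derivative_eq_intros)
  qed
  then have "deriv (\<lambda>x. f (c * x + d)) = (\<lambda>x. c * deriv f (c * x + d))"
    by (intro ext DERIV_imp_deriv)
  then show ?case
    using Suc d by (auto simp: times_differentiable_Suc field_differentiable_def intro!: times_differentiable_mult)
qed simp

text \<open>Taking all polynomials \<open>p\<close> makes the family closed under differentiation, so that first-order
  differentiability at 0 already gives smoothness.\<close>

definition flat :: "real poly \<Rightarrow> real \<Rightarrow> real" where
  "flat p x = (if x > 0 then poly p (1 / x) * exp (- 1 / x) else 0)"

lemma tendsto_poly_div_exp: "((\<lambda>x::real. poly p x / exp x) \<longlongrightarrow> 0) at_top"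
proof -
  have "((\<lambda>x::real. \<Sum>i\<le>degree p. coeff p i * (x ^ i / exp x)) \<longlongrightarrow> (\<Sum>i\<le>degree p. coeff p i * 0)) at_top"
    by (intro tendsto_intros tendsto_power_div_exp_0)
  then show ?thesis by (simp add: poly_altdef sum_divide_distrib)
qed

text \<open>With y = 1/x the derivative for x > 0 is y^2 (p(y) - p'(y)) e^(-y), whence the factor
  \<open>[:0,0,1:]\<close>. At 0 the difference quotient from the right is y p(y) e^(-y), which
  tends to 0 as y grows.\<close>

lemma DERIV_flat: "(flat p has_field_derivative flat ([:0,0,1:] * (p - pderiv p)) x) (at x)"
proof -
  consider "x > 0" | "x < 0" | "x = 0" by linarith
  then show ?thesis
  proof cases
    case 1
    have "((\<lambda>x. poly p (1 / x) * exp (- 1 / x)) has_field_derivative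
        flat ([:0,0,1:] * (p - pderiv p)) x) (at x)"
      using 1 by (auto intro!: derivative_eq_intros poly_DERIV[THEN DERIV_chain2]
        simp: flat_def field_simps power2_eq_square)
    then show ?thesis
      by (rule has_field_derivative_transform_within_open[where S = "{0<..}"]) (use 1 in \<open>auto simp: flat_def\<close>)
  next
    case 2
    have "((\<lambda>x. 0) has_field_derivative flat ([:0,0,1:] * (p - pderiv p)) x) (at x)"
      using 2 by (simp add: flat_def)
    then show ?thesis
      by (rule has_field_derivative_transform_within_open[where S = "{..<0}"]) (use 2 in \<open>auto simp: flat_def\<close>)
  next
    case 3
    have "((\<lambda>h. flat p h / h) \<longlongrightarrow> 0) (at 0)"
    proof (rule filterlim_split_at)
      have "((\<lambda>h. poly ([:0,1:] * p) (inverse h) / exp (inverse h)) \<longlongrightarrow> 0) (at_right 0)"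
        by (rule filterlim_compose[OF tendsto_poly_div_exp filterlim_inverse_at_top_right])
      then show "((\<lambda>h. flat p h / h) \<longlongrightarrow> 0) (at_right 0)"
      proof (rule Lim_transform_eventually)
        show "\<forall>\<^sub>F h in at_right 0. poly ([:0,1:] * p) (inverse h) / exp (inverse h) = flat p h / h"
          by (intro eventually_at_right_less[THEN eventually_mono])
             (simp add: flat_def exp_minus field_simps)
      qed
      have "\<forall>\<^sub>F h in at_left (0::real). 0 = flat p h / h"
        by (auto simp: eventually_at_filter flat_def)
      then show "((\<lambda>h. flat p h / h) \<longlongrightarrow> 0) (at_left 0)"
        by (rule Lim_transform_eventually[OF tendsto_const])
    qed
    then show ?thesis using 3 by (simp add: DERIV_def flat_def)
  qed
qed

lemma times_differentiable_flat: "times_differentiable n (flat p)"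
proof (rule times_differentiable_closed[where F = "range flat"])
  fix f x assume "f \<in> range flat"
  then obtain p where p: "f = flat p" by blast
  show "f field_differentiable (at x)" unfolding p field_differentiable_def using DERIV_flat by blast
  have "deriv f = flat ([:0,0,1:] * (p - pderiv p))"
    unfolding p by (intro ext DERIV_imp_deriv DERIV_flat)
  then show "deriv f \<in> range flat" by blast
qed auto

section \<open>Compactly supported smooth functions\<close>

lemma test_function_support:
  assumes "test_function \<psi>"
  obtains a b where "a \<le> b" "\<And>x. x \<notin> {a..b} \<Longrightarrow> \<psi> x = 0"
proof -
  have "bounded {x. \<psi> x \<noteq> 0}"
    using assms bounded_subset[OF compact_imp_bounded closure_subset] by (auto simp: test_function_def)
  then obtain r where "\<And>x. \<psi> x \<noteq> 0 \<Longrightarrow> \<bar>x\<bar> \<le> r"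
    by (auto simp: bounded_iff)
  then have "\<And>x. x \<notin> {-\<bar>r\<bar>..\<bar>r\<bar>} \<Longrightarrow> \<psi> x = 0" by force
  then show ?thesis using that[of "-\<bar>r\<bar>" "\<bar>r\<bar>"] by simp
qed

lemma test_functionI_support:
  assumes "\<And>n. times_differentiable n \<psi>" "\<And>x. x \<notin> {a..b} \<Longrightarrow> \<psi> x = 0"
  shows "test_function \<psi>"
proof -
  have "closure {x. \<psi> x \<noteq> 0} \<subseteq> {a..b}"
    using assms(2) by (intro closure_minimal) (auto, force+)
  then show ?thesis
    unfolding test_function_iff using assms(1)
    by (auto simp: compact_eq_bounded_closed intro: bounded_subset[OF bounded_closed_interval])
qed

text \<open>The parameter \<open>k\<close> controls steepness: on (a, b) the function is
  exp(-(1/(x-a) + 1/(b-x))/k), which tends to 1 as \<open>k\<close> grows. The arguments are written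
  in the affine shape c x + d so that closure under affine substitution applies.\<close>

definition bump :: "real \<Rightarrow> real \<Rightarrow> real \<Rightarrow> real \<Rightarrow> real" where
  "bump k a b x = flat 1 (k * x + - k * a) * flat 1 (- k * x + k * b)"

lemma bump_eq:
  assumes "k > 0"
  shows "bump k a b x = (if a < x \<and> x < b then exp (- (1 / (x - a) + 1 / (b - x)) / k) else 0)"
proof -
  have "k * x + - k * a = k * (x - a)" "- k * x + k * b = k * (b - x)" by (auto simp: algebra_simps)
  then show ?thesis using assms
    by (auto simp: bump_def flat_def zero_less_mult_iff exp_add[symmetric] divide_simps)
qed

lemma test_function_bump:
  assumes "k > 0"
  shows "test_function (bump k a b)"
proof (rule test_functionI_support)
  show "times_differentiable n (bump k a b)" for n
    unfolding bump_def[abs_def]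
    by (intro times_differentiable_mult times_differentiable_affine times_differentiable_flat)
  show "bump k a b x = 0" if "x \<notin> {a..b}" for x
    using that by (auto simp: bump_eq[OF assms])
qed

lemma test_function_DERIV:
  assumes "test_function \<psi>"
  shows "(\<psi> has_field_derivative deriv \<psi> x) (at x)"
  using assms by (auto simp: test_function_iff dest: spec[of _ "Suc 0"] 
    simp: times_differentiable_Suc field_differentiable_derivI)

lemma test_function_deriv:
  assumes "test_function \<psi>"
  shows "test_function (deriv \<psi>)"
proof -
  obtain a b where ab: "\<And>x. x \<notin> {a..b} \<Longrightarrow> \<psi> x = 0"
    using assms by (rule test_function_support) blast
  \<comment> \<open>The complement of \<open>{a..b}\<close> is open, so \<open>\<psi>\<close>
    vanishes in a neighbourhood of \<open>x\<close> and not only at \<open>x\<close>.\<close>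
  have "deriv \<psi> x = 0" if "x \<notin> {a..b}" for x
  proof (rule DERIV_imp_deriv, rule has_field_derivative_transform_within_open[OF DERIV_const])
    show "open (- {a..b})" by (simp add: open_Compl)
  qed (use that ab in auto)
  moreover have "times_differentiable n (deriv \<psi>)" for n
    using assms by (auto simp: test_function_iff times_differentiable_Suc dest: spec[of _ "Suc n"])
  ultimately show ?thesis by (intro test_functionI_support)
qed

lemma test_function_continuous:
  assumes "test_function \<psi>" shows "continuous_on A \<psi>"
  by (meson DERIV_isCont assms continuous_at_imp_continuous_on test_function_DERIV)

section \<open>Absolutely continuous representatives\<close>

lemma locally_integrable_iff:
  "locally_integrable f \<longleftrightarrow> (\<forall>a b. f absolutely_integrable_on {a..b})"
proof
  assume *: "\<forall>a b. f absolutely_integrable_on {a..b}"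
  show "locally_integrable f"
    unfolding locally_integrable_def
  proof (intro allI impI)
    fix K :: "real set" assume K: "compact K"
    then obtain r where "\<forall>x\<in>K. \<bar>x\<bar> \<le> r"
      by (auto dest!: compact_imp_bounded simp: bounded_iff)
    then have "K \<subseteq> {-r..r}" by (auto simp: abs_le_iff)
    with K show "f absolutely_integrable_on K"
      using * by (intro set_integrable_subset[of lebesgue "{-r..r}" f K]) (auto intro: fmeasurableD lmeasurable_compact)
  qed
qed (simp add: locally_integrable_def)

text \<open>By Lebesgue differentiation almost every value \<open>w x\<close> is the limit of
  averages over \<open>{x..x+h}\<close>, and these averages are all 0.\<close>

lemma integral_zero_imp_AE_zero:
  fixes w :: "real \<Rightarrow> 'a::euclidean_space"
  assumes "\<And>a b. w integrable_on {a..b}" "\<And>a b. a < b \<Longrightarrow> integral {a..b} w = 0"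
  shows "AE x in lebesgue. w x = 0"
proof -
  obtain N where "negligible N" and N: "\<And>x e. \<lbrakk>x \<notin> N; 0 < e\<rbrakk> \<Longrightarrow>
      \<exists>d>0. \<forall>h. 0 < h \<and> h < d \<longrightarrow> norm (integral (cbox x (x + h *\<^sub>R One)) w /\<^sub>R h ^ DIM(real) - w x) < e"
    using integrable_ccontinuous_explicit[of w] assms(1) by (metis box_real(2))
  have "w x = 0" if xN: "x \<notin> N" for x
  proof (rule ccontr)
    assume "w x \<noteq> 0"
    then obtain d where "d > 0"
      and "\<forall>h. 0 < h \<and> h < d \<longrightarrow> norm (integral {x..x+h} w /\<^sub>R h - w x) < norm (w x)"
      using N[OF xN, of "norm (w x)"] by auto
    then have "norm (integral {x..x+d/2} w /\<^sub>R (d/2) - w x) < norm (w x)"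
      by (auto dest: spec[of _ "d/2"])
    with \<open>d > 0\<close> show False by (simp add: assms(2))
  qed
  then show ?thesis
    using \<open>negligible N\<close> unfolding eventually_ae_filter_negligible by blast
qed

lemma test_function_scaleR_integrable:
  fixes w :: "real \<Rightarrow> 'a::euclidean_space"
  assumes "test_function \<psi>" "\<And>a b. w absolutely_integrable_on {a..b}"
  shows "integrable lebesgue (\<lambda>x. \<psi> x *\<^sub>R w x)"
proof -
  obtain a b where ab: "\<And>x. x \<notin> {a..b} \<Longrightarrow> \<psi> x = 0"
    using assms(1) by (rule test_function_support) blast
  have "(\<lambda>x. \<psi> x *\<^sub>R w x) absolutely_integrable_on {a..b}"
    using assms by (intro absolutely_integrable_continuous_scaleR test_function_continuous)
  moreover have "indicator {a..b} x *\<^sub>R \<psi> x *\<^sub>R w x = \<psi> x *\<^sub>R w x" for x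
    using ab[of x] by (cases "x \<in> {a..b}") auto
  ultimately show ?thesis unfolding set_integrable_def by (simp del: scaleR_scaleR)
qed

lemma LINT_eq_integral_support:
  fixes f :: "real \<Rightarrow> 'a::euclidean_space"
  assumes "integrable lebesgue f" "\<And>x. x \<notin> {a..b} \<Longrightarrow> f x = 0"
  shows "integral\<^sup>L lebesgue f = integral {a..b} f"
proof -
  have "(\<lambda>x. if x \<in> {a..b} then f x else 0) = f" using assms(2) by auto
  then have "(f has_integral integral\<^sup>L lebesgue f) {a..b}"
    using has_integral_integral_lebesgue[OF assms(1)] has_integral_restrict_UNIV[of "{a..b}" f] by simp
  then show ?thesis by (simp add: integral_unique)
qed

text \<open>The bumps lie between 0 and the indicator of the open interval and converge to it
  pointwise, so dominated convergence applies. The two endpoints, where all bumps vanish, do not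
  change the integral.\<close>

lemma bump_approx:
  fixes w :: "real \<Rightarrow> 'a::euclidean_space"
  assumes w: "\<And>a b. w absolutely_integrable_on {a..b}"
  shows "(\<lambda>k. LINT x|lebesgue. bump (real (Suc k)) a b x *\<^sub>R w x) \<longlonglongrightarrow> integral {a..b} w"
proof -
  have w': "w absolutely_integrable_on {a<..<b}"
    by (rule set_integrable_subset[OF w[of a b]]) auto
  have "(\<lambda>k. LINT x|lebesgue. bump (real (Suc k)) a b x *\<^sub>R w x) \<longlonglongrightarrow>
      (LINT x|lebesgue. indicator {a<..<b} x *\<^sub>R w x)"
  proof (rule integral_dominated_convergence)
    show "(\<lambda>x. indicator {a<..<b} x *\<^sub>R w x) \<in> borel_measurable lebesgue"
      using w' by (simp add: set_integrable_def)
    show "(\<lambda>x. bump (real (Suc k)) a b x *\<^sub>R w x) \<in> borel_measurable lebesgue" for k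
      by (intro borel_measurable_integrable test_function_scaleR_integrable test_function_bump w) auto
    show "integrable lebesgue (\<lambda>x. norm (indicator {a<..<b} x *\<^sub>R w x))"
      using w' unfolding set_integrable_def by (rule integrable_norm)
    show "AE x in lebesgue. (\<lambda>k. bump (real (Suc k)) a b x *\<^sub>R w x) \<longlonglongrightarrow> indicator {a<..<b} x *\<^sub>R w x"
    proof (intro AE_I2 tendsto_scaleR tendsto_const)
      fix x
      show "(\<lambda>k. bump (real (Suc k)) a b x) \<longlonglongrightarrow> indicator {a<..<b} x"
      proof (cases "a < x \<and> x < b")
        case True
        define c where "c = - (1 / (x - a) + 1 / (b - x))"
        have "(\<lambda>k. exp (c * inverse (real (Suc k)))) \<longlonglongrightarrow> exp (c * 0)"
          by (intro tendsto_intros LIMSEQ_inverse_real_of_nat)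
        then show ?thesis using True unfolding bump_eq[OF of_nat_0_less_iff[THEN iffD2, OF zero_less_Suc]] c_def[symmetric]
          by (simp add: divide_inverse)
      next
        case False
        then have "bump (real (Suc k)) a b x = 0" for k
          by (auto simp: bump_eq simp del: of_nat_Suc)
        with False show ?thesis by (auto simp: indicator_def)
      qed
    qed
    show "AE x in lebesgue. norm (bump (real (Suc k)) a b x *\<^sub>R w x) \<le> norm (indicator {a<..<b} x *\<^sub>R w x)" for k
    proof (rule AE_I2)
      fix x
      have "(- (1 / (x - a)) - 1 / (b - x)) / (1 + real k) \<le> 0" if "a < x" "x < b"
      proof -
        have "0 \<le> 1 / (x - a)" "0 \<le> 1 / (b - x)" using that by auto
        then show ?thesis by (intro divide_nonpos_pos) linarith+
      qed
      then show "norm (bump (real (Suc k)) a b x *\<^sub>R w x) \<le> norm (indicator {a<..<b} x *\<^sub>R w x)"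
        by (auto simp: bump_eq indicator_def intro!: mult_left_le_one_le)
    qed
  qed
  also have "(LINT x|lebesgue. indicator {a<..<b} x *\<^sub>R w x) = integral {a<..<b} w"
    using set_lebesgue_integral_eq_integral(2)[OF w'] by (simp add: set_lebesgue_integral_def)
  finally show ?thesis by (simp add: integral_open_interval_real)
qed

text \<open>Testing with bumps and passing to the limit makes the integral of \<open>w\<close> over
  every interval vanish.\<close>

lemma fundamental_lemma:
  assumes w: "locally_integrable w"
    and zero: "\<And>\<psi>. test_function \<psi> \<Longrightarrow> (LINT x|lebesgue. \<psi> x *\<^sub>R w x) = 0"
  shows "AE x in lebesgue. w x = 0"
proof (rule integral_zero_imp_AE_zero)
  have w': "w absolutely_integrable_on {a..b}" for a b
    using w by (simp add: locally_integrable_iff)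
  then show "w integrable_on {a..b}" for a b
    by (rule set_lebesgue_integral_eq_integral(1))
  show "integral {a..b} w = 0" for a b
    using bump_approx[OF w', of a b] zero[OF test_function_bump]
    by (auto simp: LIMSEQ_const_iff)
qed

text \<open>The primitive vanishing to the left of the support is constant to its right, with the
  total integral as its value. Mean zero is thus what makes the primitive compactly
  supported.\<close>

lemma test_function_antiderivative:
  assumes "test_function \<zeta>" "(LINT x|lebesgue. \<zeta> x) = 0"
  obtains \<omega> where "test_function \<omega>" "deriv \<omega> = \<zeta>"
proof -
  obtain a b where ab: "a \<le> b" "\<And>x. x \<notin> {a..b} \<Longrightarrow> \<zeta> x = 0"
    using assms(1) by (rule test_function_support) blast
  obtain F where F: "\<And>x. (F has_vector_derivative \<zeta> x) (at x)"
    using einterval_antiderivative[of "-\<infinity>" \<infinity> \<zeta>] test_function_DERIV[OF assms(1), THEN DERIV_isCont]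
    by auto
  define \<omega> where "\<omega> x = F x - F a" for x
  have D: "(\<omega> has_field_derivative \<zeta> x) (at x)" for x
    unfolding \<omega>_def by (auto intro!: derivative_eq_intros F[THEN has_real_derivative_iff_has_vector_derivative[THEN iffD2]])
  then have deriv: "deriv \<omega> = \<zeta>" by (intro ext DERIV_imp_deriv)
  have ac: "has_ac_deriv \<omega> \<zeta>"
    by (rule has_ac_deriv_C1) (use D in \<open>auto simp: has_real_derivative_iff_has_vector_derivative
      intro: test_function_continuous[OF assms(1)]\<close>)
  have int: "integrable lebesgue \<zeta>"
    using test_function_scaleR_integrable[OF assms(1), of "\<lambda>_. 1::real"] by (simp add: absolutely_integrable_continuous_real)
  have "\<omega> x = 0" if "x \<notin> {a..b}" for x
  proof (cases "x < a")
    case True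
    have "integral {x..a} \<zeta> = integral {x..a} (\<lambda>_. 0)"
      by (rule integral_spike[of "{a}"]) (use ab in auto)
    then show ?thesis using has_ac_derivD(2)[OF ac, of x a] True by (simp add: \<omega>_def)
  next
    case False
    have "integral {a..x} \<zeta> = integral\<^sup>L lebesgue \<zeta>"
      using ab False that by (intro LINT_eq_integral_support[symmetric] int) auto
    then show ?thesis using has_ac_derivD(2)[OF ac, of a x] that False assms(2) by (simp add: \<omega>_def)
  qed
  moreover have "times_differentiable n \<omega>" for n
  proof (cases n)
    case (Suc k)
    then show ?thesis using D deriv assms(1)
      by (auto simp: times_differentiable_Suc test_function_iff field_differentiable_def)
  qed simp
  ultimately have "test_function \<omega>" by (intro test_functionI_support)
  then show ?thesis using deriv that by blast
qed

lemma test_function_diff_mult: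
  assumes "test_function \<psi>" "test_function \<eta>"
  shows "test_function (\<lambda>x. \<psi> x - c * \<eta> x)"
proof -
  obtain a b a' b' where ab: "\<And>x. x \<notin> {a..b} \<Longrightarrow> \<psi> x = 0" "\<And>x. x \<notin> {a'..b'} \<Longrightarrow> \<eta> x = 0"
    using test_function_support[OF assms(1)] test_function_support[OF assms(2)] by metis
  have "times_differentiable n (\<lambda>x. \<psi> x + (-c) * \<eta> x)" for n
    using assms by (intro times_differentiable_add times_differentiable_mult) (auto simp: test_function_iff)
  then show ?thesis
  proof (intro test_functionI_support[of _ "min a a'" "max b b'"])
    show "\<psi> x - c * \<eta> x = 0" if "x \<notin> {min a a'..max b b'}" for x
      using that ab(1)[of x] ab(2)[of x] by (force simp: min_def max_def split: if_splits)
  qed simp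
qed

text \<open>Du Bois-Reymond: subtracting an absolutely continuous primitive of \<open>v\<close> reduces to a function
  whose weak derivative vanishes.\<close>

lemma weak_deriv_ac_representative:
  assumes u: "locally_integrable u" and v: "locally_integrable v"
    and uv: "\<And>\<psi>. test_function \<psi> \<Longrightarrow>
      (LINT x|lebesgue. deriv \<psi> x *\<^sub>R u x) = - (LINT x|lebesgue. \<psi> x *\<^sub>R v x)"
  obtains U where "has_ac_deriv U v" "AE x in lebesgue. U x = u x"
proof -
  have v': "v absolutely_integrable_on {a..b}" for a b using v by (simp add: locally_integrable_iff)
  have u': "u absolutely_integrable_on {a..b}" for a b using u by (simp add: locally_integrable_iff)
  obtain V where V: "has_ac_deriv V v"
    using has_ac_deriv_indefinite[OF v'] by blast
  have V': "V absolutely_integrable_on {a..b}" for a b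
    by (intro absolutely_integrable_continuous_real has_ac_deriv_continuous[OF V])
  define w where "w x = u x - V x" for x
  have w': "w absolutely_integrable_on {a..b}" for a b
    unfolding w_def[abs_def] using u' V' by (rule set_integral_diff(1))
  have w0: "(LINT x|lebesgue. deriv \<psi> x *\<^sub>R w x) = 0" if \<psi>: "test_function \<psi>" for \<psi>
  proof -
    obtain a b where ab: "a \<le> b" "\<And>x. x \<notin> {a..b} \<Longrightarrow> \<psi> x = 0"
      using \<psi> by (rule test_function_support) blast
    \<comment> \<open>The interval is enlarged by 1 on both sides so that the boundary terms of the
      product rule vanish: \<open>ab\<close> gives zeros only outside \<open>{a..b}\<close>.\<close>
    have *: "\<psi> x = 0" "deriv \<psi> x = 0" if "x \<notin> {a-1..b+1}" for x
    proof -
      show "deriv \<psi> x = 0"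
      proof (rule DERIV_imp_deriv, rule has_field_derivative_transform_within_open[OF DERIV_const])
        show "open (- {a..b})" by (simp add: open_Compl)
      qed (use that ab in auto)
      show "\<psi> x = 0" using that by (intro ab(2)) auto
    qed
    have "has_ac_deriv \<psi> (deriv \<psi>)"
      by (rule has_ac_deriv_C1) (use test_function_DERIV[OF \<psi>] test_function_deriv[OF \<psi>] in
        \<open>auto simp: has_real_derivative_iff_has_vector_derivative intro: test_function_continuous\<close>)
    then have "integral {a-1..b+1} (\<lambda>x. \<psi> x *\<^sub>R v x + deriv \<psi> x *\<^sub>R V x) = 0"
      using has_ac_derivD(2)[OF has_ac_deriv_scaleR[OF V], of \<psi> "deriv \<psi>" "a-1" "b+1"] ab by simp
    also have "integral {a-1..b+1} (\<lambda>x. \<psi> x *\<^sub>R v x + deriv \<psi> x *\<^sub>R V x) =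
        (LINT x|lebesgue. \<psi> x *\<^sub>R v x + deriv \<psi> x *\<^sub>R V x)"
      using * \<psi> test_function_deriv[OF \<psi>] v' V'
      by (intro LINT_eq_integral_support[symmetric] Bochner_Integration.integrable_add test_function_scaleR_integrable) auto
    also have "\<dots> = (LINT x|lebesgue. \<psi> x *\<^sub>R v x) + (LINT x|lebesgue. deriv \<psi> x *\<^sub>R V x)"
      using \<psi> test_function_deriv[OF \<psi>] v' V'
      by (intro Bochner_Integration.integral_add test_function_scaleR_integrable)
    finally have "(LINT x|lebesgue. deriv \<psi> x *\<^sub>R V x) = (LINT x|lebesgue. deriv \<psi> x *\<^sub>R u x)"
      using uv[OF \<psi>] by (simp add: add_eq_0_iff)
    moreover have "(LINT x|lebesgue. deriv \<psi> x *\<^sub>R w x) =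
        (LINT x|lebesgue. deriv \<psi> x *\<^sub>R u x) - (LINT x|lebesgue. deriv \<psi> x *\<^sub>R V x)"
      unfolding w_def scaleR_diff_right using test_function_deriv[OF \<psi>] u' V'
      by (intro Bochner_Integration.integral_diff test_function_scaleR_integrable)
    ultimately show ?thesis by simp
  qed
  have one: "(\<lambda>_. 1::real) absolutely_integrable_on {a..b}" for a b :: real
    by (simp add: absolutely_integrable_continuous_real)
  \<comment> \<open>The integrals of the bumps tend to the length 1 of the interval, so one of them
    is nonzero; that bump becomes the normalising function \<open>\<eta>\<close>.\<close>
  have "\<exists>k. (LINT x|lebesgue. bump (real (Suc k)) 0 1 x *\<^sub>R (1::real)) \<noteq> 0"
  proof (rule ccontr)
    assume "\<not> ?thesis"
    then show False using bump_approx[OF one, of 0 1] by (simp add: LIMSEQ_const_iff)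
  qed
  then obtain k where k: "(LINT x|lebesgue. bump (real (Suc k)) 0 1 x) \<noteq> 0"
    by auto
  define \<eta> where "\<eta> = bump (real (Suc k)) 0 1"
  have \<eta>: "test_function \<eta>" "(LINT x|lebesgue. \<eta> x) \<noteq> 0"
    using k test_function_bump[of "real (Suc k)" 0 1] by (auto simp: \<eta>_def)
  have int: "integrable lebesgue \<psi>" if "test_function \<psi>" for \<psi>
    using test_function_scaleR_integrable[OF that one] by simp
  \<comment> \<open>If \<open>w\<close> is almost everywhere constant, the constant has to be its
    mean with respect to \<open>\<eta>\<close>.\<close>
  define c where "c = (LINT x|lebesgue. \<eta> x *\<^sub>R w x) /\<^sub>R (LINT x|lebesgue. \<eta> x)"
  have "AE x in lebesgue. w x - c = 0"
  proof (rule fundamental_lemma)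
    have c': "(\<lambda>x. c) absolutely_integrable_on {a..b}" for a b :: real
      by (simp add: absolutely_integrable_continuous_real)
    show "locally_integrable (\<lambda>x. w x - c)"
      unfolding locally_integrable_iff using w' c' by (auto intro: set_integral_diff(1))
    fix \<psi> assume \<psi>: "test_function \<psi>"
    \<comment> \<open>With this factor \<open>\<psi> - s \<eta>\<close> has mean zero and so is the
      derivative of a test function, against which \<open>w\<close> integrates to 0 by
      \<open>w0\<close>.\<close>
    define s where "s = (LINT x|lebesgue. \<psi> x) / (LINT x|lebesgue. \<eta> x)"
    have \<zeta>: "test_function (\<lambda>x. \<psi> x - s * \<eta> x)" using \<psi> \<eta>(1) by (rule test_function_diff_mult)
    have "(LINT x|lebesgue. \<psi> x - s * \<eta> x) = 0"
      using int[OF \<psi>] int[OF \<eta>(1)] \<eta>(2) by (simp add: s_def)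
    then obtain \<omega> where "test_function \<omega>" "deriv \<omega> = (\<lambda>x. \<psi> x - s * \<eta> x)"
      using test_function_antiderivative[OF \<zeta>] by blast
    then have "0 = (LINT x|lebesgue. \<psi> x *\<^sub>R w x - s *\<^sub>R (\<eta> x *\<^sub>R w x))"
      using w0[of \<omega>] by (simp add: scaleR_diff_left)
    also have "\<dots> = (LINT x|lebesgue. \<psi> x *\<^sub>R w x) - s *\<^sub>R (LINT x|lebesgue. \<eta> x *\<^sub>R w x)"
      using test_function_scaleR_integrable[OF \<psi> w'] test_function_scaleR_integrable[OF \<eta>(1) w']
      by (simp del: scaleR_scaleR)
    also have "s *\<^sub>R (LINT x|lebesgue. \<eta> x *\<^sub>R w x) = (LINT x|lebesgue. \<psi> x *\<^sub>R c)"
      using int[OF \<psi>] by (simp add: s_def c_def divide_inverse)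
    also have "(LINT x|lebesgue. \<psi> x *\<^sub>R w x) - \<dots> = (LINT x|lebesgue. \<psi> x *\<^sub>R (w x - c))"
      unfolding scaleR_diff_right
      by (intro Bochner_Integration.integral_diff[symmetric] test_function_scaleR_integrable \<psi> w' c')
    finally show "(LINT x|lebesgue. \<psi> x *\<^sub>R (w x - c)) = 0" by simp
  qed
  then have "AE x in lebesgue. V x + c = u x"
    by eventually_elim (simp add: w_def algebra_simps)
  moreover have "has_ac_deriv (\<lambda>x. V x + c) v"
    using V by (simp add: has_ac_deriv_def)
  ultimately show ?thesis using that by blast
qed

text \<open>The \<open>\<tau>\<close>-th weak derivative is defined through \<open>f\<close> alone; testing with a derivative shows that
  consecutive weak derivatives are weak derivatives of each other.\<close>

lemma has_weak_deriv_ac_representative: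
  assumes "has_weak_deriv \<tau> f g" "has_weak_deriv (Suc \<tau>) f h"
  obtains G where "has_ac_deriv G h" "AE x in lebesgue. G x = g x"
proof (rule weak_deriv_ac_representative[of g h])
  show "locally_integrable g" "locally_integrable h"
    using assms by (auto simp: has_weak_deriv_def)
  fix \<psi> assume \<psi>: "test_function \<psi>"
  have "(-1) ^ \<tau> * (LINT x|lebesgue. deriv \<psi> x *\<^sub>R g x) = (LINT x|lebesgue. (deriv ^^ \<tau>) (deriv \<psi>) x *\<^sub>R f x)"
    using assms(1) test_function_deriv[OF \<psi>] by (simp add: has_weak_deriv_def)
  also have "\<dots> = (-1) ^ Suc \<tau> * (LINT x|lebesgue. \<psi> x *\<^sub>R h x)"
    using assms(2) \<psi> by (simp add: has_weak_deriv_def funpow_swap1 del: power_Suc)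
  finally have "(-1) ^ \<tau> * (LINT x|lebesgue. deriv \<psi> x *\<^sub>R g x) = (-1) ^ \<tau> * - (LINT x|lebesgue. \<psi> x *\<^sub>R h x)"
    by simp
  then show "(LINT x|lebesgue. deriv \<psi> x *\<^sub>R g x) = - (LINT x|lebesgue. \<psi> x *\<^sub>R h x)"
    unfolding mult_cancel_left by simp
qed (use that in blast)

text \<open>The weak derivative of order 0 is a chosen function like all others, so its agreement
  with \<open>f\<close> has to be obtained by testing the difference.\<close>

lemma has_weak_deriv_0_AE:
  assumes "has_weak_deriv 0 f g"
  shows "AE x in lebesgue. g x = f x"
proof -
  have loc: "f absolutely_integrable_on {a..b}" "g absolutely_integrable_on {a..b}" for a b
    using assms by (auto simp: has_weak_deriv_def locally_integrable_iff)
  have "AE x in lebesgue. g x - f x = 0"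
  proof (rule fundamental_lemma)
    show "locally_integrable (\<lambda>x. g x - f x)"
      unfolding locally_integrable_iff using loc by (auto intro: set_integral_diff(1))
    fix \<psi> assume \<psi>: "test_function \<psi>"
    have "(LINT x|lebesgue. \<psi> x *\<^sub>R (g x - f x)) = (LINT x|lebesgue. \<psi> x *\<^sub>R g x) - (LINT x|lebesgue. \<psi> x *\<^sub>R f x)"
      unfolding scaleR_diff_right
      by (intro Bochner_Integration.integral_diff test_function_scaleR_integrable \<psi> loc)
    then show "(LINT x|lebesgue. \<psi> x *\<^sub>R (g x - f x)) = 0"
      using assms \<psi> by (simp add: has_weak_deriv_def)
  qed
  then show ?thesis by simp
qed

text \<open>The set of agreement is closed, and its complement is an open null set, hence
  empty.\<close>

lemma continuous_AE_eq:
  fixes g h :: "real \<Rightarrow> complex"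
  assumes "continuous_on UNIV g" "continuous_on UNIV h" "AE x in lebesgue. g x = h x"
  shows "g = h"
proof -
  have "closed {x. g x = h x}" using assms(1,2) by (rule closed_Collect_eq)
  from mem_closed_if_AE_lebesgue[OF this] assms(3) show ?thesis by auto
qed

lemma continuous_rep_eq:
  assumes "continuous_on UNIV g" "AE x in lebesgue. g x = f x"
  shows "continuous_rep f = g"
  unfolding continuous_rep_def
proof (rule the_equality)
  fix h assume h: "continuous_on UNIV h \<and> (AE x in lebesgue. h x = f x)"
  with assms(2) have "AE x in lebesgue. h x = g x" by auto
  with h assms(1) show "h = g" by (blast intro: continuous_AE_eq)
qed (use assms in blast)

section \<open>Periodic kernels and primitives vanishing at infinity\<close>

text \<open>Off the integers this is the first periodic Bernoulli function. At an integer the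
  ceiling selects the limit 1/2 from the left, which fits the closed half-lines \<open>{..c}\<close>
  that count nodes in \<open>node_count\<close>.\<close>

definition sawtooth :: "real \<Rightarrow> real" where
  "sawtooth t = t - of_int \<lceil>t\<rceil> + 1 / 2"

lemma abs_sawtooth_le: "\<bar>sawtooth t\<bar> \<le> 1 / 2"
  unfolding sawtooth_def using ceiling_correct[of t] by linarith

lemma borel_measurable_sawtooth [measurable]: "sawtooth \<in> borel_measurable borel"
  unfolding sawtooth_def[abs_def] by measurable

text \<open>For a primitive B of \<open>b\<close> the difference B(t+1) - B(t) is constant and
  equals the integral of \<open>b\<close> over a period, which is 0; so B is again periodic.
  Subtracting its mean restores mean zero and lets the step be repeated.\<close>

lemma kernel_step:
  fixes b :: "real \<Rightarrow> real"
  assumes "continuous_on UNIV b" "\<And>t. b (t + 1) = b t" "integral {0..1} b = 0"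
  obtains b' where "continuous_on UNIV b'" "\<And>t. b' (t + 1) = b' t" "integral {0..1} b' = 0"
    "\<And>t. (b' has_real_derivative b t) (at t)"
proof -
  obtain B where "\<And>t. (B has_vector_derivative b t) (at t)"
    using einterval_antiderivative[of "-\<infinity>" \<infinity> b] assms(1) by (auto simp: continuous_on_eq_continuous_at)
  then have B: "(B has_real_derivative b t) (at t)" for t
    by (simp add: has_real_derivative_iff_has_vector_derivative)
  then have cont: "continuous_on A B" for A
    by (meson DERIV_isCont continuous_at_imp_continuous_on)
  define b' where "b' t = B t - integral {0..1} B" for t
  have "has_ac_deriv B b"
    by (rule has_ac_deriv_C1) (use B assms(1) in \<open>auto simp: has_real_derivative_iff_has_vector_derivative\<close>)
  then have B1: "B 1 = B 0"
    using has_ac_derivD(2)[of B b 0 1] assms(3) by simp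
  have "((\<lambda>t. B (t + 1) - B t) has_real_derivative 0) (at t)" for t
  proof -
    have "(B has_real_derivative b (t + 1)) (at (t + 1))" by (rule B)
    then have "((\<lambda>t. B (t + 1)) has_real_derivative b t) (at t)"
      unfolding DERIV_shift assms(2) by simp
    from DERIV_diff[OF this B[of t]] show ?thesis by simp
  qed
  then have "B (t + 1) - B t = B (0 + 1) - B 0" for t
    using DERIV_isconst_all[of "\<lambda>t. B (t + 1) - B t"] by blast
  then have "b' (t + 1) = b' t" for t
    using B1 by (simp add: b'_def)
  moreover have "continuous_on UNIV b'"
    unfolding b'_def by (intro continuous_intros cont)
  moreover have "integral {0..1} b' = 0"
    unfolding b'_def by (subst Henstock_Kurzweil_Integration.integral_diff)
      (auto intro!: integrable_continuous_real cont)
  moreover have "(b' has_real_derivative b t) (at t)" for t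
    unfolding b'_def by (auto intro!: derivative_eq_intros B)
  ultimately show ?thesis using that by blast
qed

lemma periodic_continuous_bounded:
  fixes b :: "real \<Rightarrow> real"
  assumes "continuous_on UNIV b" "\<And>t. b (t + 1) = b t"
  obtains M where "\<And>t. \<bar>b t\<bar> \<le> M"
proof -
  interpret periodic_fun_simple' b by unfold_locales (rule assms(2))
  have "bounded (b ` {0..1})"
    by (intro compact_imp_bounded compact_continuous_image continuous_on_subset[OF assms(1)]) auto
  then obtain M where M: "\<And>t. t \<in> {0..1} \<Longrightarrow> \<bar>b t\<bar> \<le> M"
    by (auto simp: bounded_iff simp del: atLeastAtMost_iff)
  have "\<bar>b t\<bar> \<le> M" for t
  proof -
    have "b t = b (frac t)" using plus_of_int[of "frac t" "\<lfloor>t\<rfloor>"] by (simp add: frac_def)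
    then show ?thesis using M[of "frac t"] by (simp add: frac_lt_1 less_imp_le)
  qed
  then show ?thesis using that by blast
qed

text \<open>Up to normalisation these are the periodic Bernoulli functions.\<close>

lemma periodic_kernels:
  obtains b :: "nat \<Rightarrow> real \<Rightarrow> real" where "b 0 = sawtooth"
    "\<And>k. continuous_on UNIV (b (Suc k))"
    "\<And>k t. k \<ge> 1 \<or> t \<notin> \<int> \<Longrightarrow> (b (Suc k) has_real_derivative b k t) (at t)"
    "\<And>k. \<exists>M. \<forall>t. \<bar>b k t\<bar> \<le> M"
proof -
  \<comment> \<open>A primitive of the sawtooth on each unit interval. Squaring turns the one-sided
    values 1/2 and -1/2 at an integer into the same number, so the jump disappears; 1/24 is the mean
    of (t - 1/2)^2 / 2 over \<open>{0..1}\<close>.\<close>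
  define b1 :: "real \<Rightarrow> real" where "b1 t = (sawtooth t)\<^sup>2 / 2 - 1 / 24" for t
  have b1_eq: "b1 t = (t - of_int n - 1 / 2)\<^sup>2 / 2 - 1 / 24" if "t \<in> {of_int n..of_int n + 1}" for t n
  proof (cases "t = of_int n")
    case True
    then show ?thesis by (simp add: b1_def sawtooth_def power2_eq_square)
  next
    case False
    then have "\<lceil>t\<rceil> = n + 1" using that by (intro ceiling_unique) auto
    then show ?thesis by (simp add: b1_def sawtooth_def algebra_simps)
  qed
  have "isCont b1 t" for t
  proof -
    define n where "n = \<lceil>t\<rceil>"
    have c: "continuous_on {of_int k..of_int k + 1} b1" for k
    proof -
      have "continuous_on {of_int k..of_int k + 1} (\<lambda>t::real. (t - of_int k - 1 / 2)\<^sup>2 / 2 - 1 / 24)"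
        by (intro continuous_intros) auto
      then show ?thesis by (rule continuous_on_eq) (simp add: b1_eq)
    qed
    have "continuous_on ({of_int (n-1)..of_int (n-1) + 1} \<union> {of_int n..of_int n + 1}) b1"
      by (intro continuous_on_closed_Un c) auto
    moreover have "{of_int (n-1)..of_int (n-1) + 1} \<union> {of_int n..of_int n + 1} = {of_int n - 1..of_int n + (1::real)}"
      by auto
    ultimately have "continuous_on {of_int n - 1..of_int n + (1::real)} b1" by simp
    then show ?thesis
      by (rule continuous_on_interior) (use ceiling_correct[of t] in \<open>simp add: n_def, linarith\<close>)
  qed
  then have b1_cont: "continuous_on UNIV b1" by (simp add: continuous_on_eq_continuous_at)
  have b1_per: "b1 (t + 1) = b1 t" for t by (simp add: b1_def sawtooth_def)
  have "((\<lambda>t. (t - of_int 0 - 1 / 2)\<^sup>2 / 2 - 1 / 24) has_integral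
     ((1 - 1/2) ^ 3 / 6 - 1 / 24) - ((0 - 1/2) ^ 3 / 6 - 0 / 24)) {0..1::real}"
    by (rule fundamental_theorem_of_calculus)
       (auto intro!: derivative_eq_intros simp: has_real_derivative_iff_has_vector_derivative[symmetric] power2_eq_square)
  then have "integral {0..1} (\<lambda>t::real. (t - of_int 0 - 1 / 2)\<^sup>2 / 2 - 1 / 24) = 0"
    by (auto dest!: integral_unique simp: power3_eq_cube)
  moreover have "integral {0..1} b1 = integral {0..1} (\<lambda>t::real. (t - of_int 0 - 1 / 2)\<^sup>2 / 2 - 1 / 24)"
    by (rule Henstock_Kurzweil_Integration.integral_cong, rule b1_eq) simp
  ultimately have b1_int: "integral {0..1} b1 = 0" by simp
  have b1_D: "(b1 has_real_derivative sawtooth t) (at t)" if "t \<notin> \<int>" for t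
  proof -
    define n where "n = \<lfloor>t\<rfloor>"
    have tn: "of_int n < t" "t < of_int n + 1"
      using that floor_correct[of t] unfolding n_def by (auto simp: less_le)
    then have "\<lceil>t\<rceil> = n + 1" by (intro ceiling_unique) auto
    then have "((\<lambda>t. (t - of_int n - 1 / 2)\<^sup>2 / 2 - 1 / 24) has_real_derivative sawtooth t) (at t)"
      by (auto intro!: derivative_eq_intros simp: sawtooth_def)
    then show ?thesis
      by (rule has_field_derivative_transform_within_open[where S = "{of_int n<..<of_int n + 1}"])
         (use tn in \<open>auto simp: b1_eq[where n = n]\<close>)
  qed
  let ?P = "\<lambda>b::real \<Rightarrow> real. continuous_on UNIV b \<and> (\<forall>t. b (t + 1) = b t) \<and> integral {0..1} b = 0"
  \<comment> \<open>The recursion starts from the continuous \<open>b1\<close>; the discontinuous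
    sawtooth is put in front of the sequence afterwards, which shifts the index by one.\<close>
  have "\<exists>c. \<forall>n. (?P (c n) \<and> (n = 0 \<longrightarrow> c n = b1)) \<and> (\<forall>t. (c (Suc n) has_real_derivative c n t) (at t))"
  proof (rule dependent_nat_choice)
    show "\<exists>b. ?P b \<and> ((0::nat) = 0 \<longrightarrow> b = b1)"
      using b1_cont b1_per b1_int by blast
    fix b :: "real \<Rightarrow> real" and n :: nat
    assume "?P b \<and> (n = 0 \<longrightarrow> b = b1)"
    then obtain b' where "?P b'" "\<And>t. (b' has_real_derivative b t) (at t)"
      using kernel_step[of b] by metis
    then show "\<exists>b'. (?P b' \<and> (Suc n = 0 \<longrightarrow> b' = b1)) \<and> (\<forall>t. (b' has_real_derivative b t) (at t))"
      by blast
  qed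
  then obtain c where c: "\<And>n. ?P (c n)" "c 0 = b1" "\<And>n t. (c (Suc n) has_real_derivative c n t) (at t)"
    by blast
  define b where "b k = (case k of 0 \<Rightarrow> sawtooth | Suc j \<Rightarrow> c j)" for k
  show ?thesis
  proof (rule that[of b])
    show "b 0 = sawtooth" by (simp add: b_def)
    show "continuous_on UNIV (b (Suc k))" for k using c(1)[of k] by (simp add: b_def)
    show "(b (Suc k) has_real_derivative b k t) (at t)" if "k \<ge> 1 \<or> t \<notin> \<int>" for k t
      using that c(2,3) b1_D by (cases k) (auto simp: b_def)
    show "\<exists>M. \<forall>t. \<bar>b k t\<bar> \<le> M" for k
    proof (cases k)
      case 0
      then show ?thesis using abs_sawtooth_le by (simp only: b_def nat.case) blast
    next
      case (Suc j)
      obtain M where "\<And>t. \<bar>c j t\<bar> \<le> M"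
        using c(1)[of j] by (auto intro: periodic_continuous_bounded[of "c j"])
      then show ?thesis using Suc by (auto simp: b_def)
    qed
  qed
qed

section \<open>Behaviour of primitives at infinity\<close>

lemma has_ac_deriv_tendsto_at_top:
  assumes uv: "has_ac_deriv u v" and v: "integrable lebesgue v"
  shows "(u \<longlongrightarrow> u a + (LINT x|lebesgue. indicator {a..} x *\<^sub>R v x)) at_top"
proof -
  have "((\<lambda>t. LINT x|lebesgue. indicator {a..t} x *\<^sub>R v x) \<longlongrightarrow> (LINT x|lebesgue. indicator {a..} x *\<^sub>R v x)) at_top"
  proof (rule integral_dominated_convergence_at_top[where w = "\<lambda>x. norm (v x)"])
    show "integrable lebesgue (\<lambda>x. norm (v x))" using v by (rule integrable_norm)
    show "AE x in lebesgue. ((\<lambda>t. indicator {a..t} x *\<^sub>R v x) \<longlongrightarrow> indicator {a..} x *\<^sub>R v x) at_top"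
    proof (rule AE_I2)
      fix x
      have "\<forall>\<^sub>F t in at_top. indicator {a..} x *\<^sub>R v x = indicator {a..t} x *\<^sub>R v x"
        using eventually_ge_at_top[of x] by eventually_elim (auto simp: indicator_def)
      then show "((\<lambda>t. indicator {a..t} x *\<^sub>R v x) \<longlongrightarrow> indicator {a..} x *\<^sub>R v x) at_top"
        by (rule Lim_transform_eventually[OF tendsto_const])
    qed
    show "\<forall>\<^sub>F t in at_top. AE x in lebesgue. norm (indicator {a..t} x *\<^sub>R v x) \<le> norm (v x)"
      by (auto simp: indicator_def)
  qed (auto intro!: borel_measurable_scaleR borel_measurable_indicator borel_measurable_integrable[OF v])
  then have "((\<lambda>t. u a + (LINT x|lebesgue. indicator {a..t} x *\<^sub>R v x)) \<longlongrightarrow> u a + (LINT x|lebesgue. indicator {a..} x *\<^sub>R v x)) at_top"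
    by (intro tendsto_intros)
  moreover have "\<forall>\<^sub>F t in at_top. u a + (LINT x|lebesgue. indicator {a..t} x *\<^sub>R v x) = u t"
    using eventually_ge_at_top[of a]
  proof eventually_elim
    case (elim t)
    then show ?case
      using set_lebesgue_integral_eq_integral(2)[OF has_ac_derivD(1)[OF uv, of a t]] has_ac_derivD(2)[OF uv elim]
      by (simp add: set_lebesgue_integral_def)
  qed
  ultimately show ?thesis by (rule Lim_transform_eventually)
qed

lemma has_ac_deriv_tendsto_at_bot:
  assumes uv: "has_ac_deriv u v" and v: "integrable lebesgue v"
  shows "(u \<longlongrightarrow> u b - (LINT x|lebesgue. indicator {..b} x *\<^sub>R v x)) at_bot"
proof -
  have "((\<lambda>t. LINT x|lebesgue. indicator {-t..b} x *\<^sub>R v x) \<longlongrightarrow> (LINT x|lebesgue. indicator {..b} x *\<^sub>R v x)) at_top"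
  proof (rule integral_dominated_convergence_at_top[where w = "\<lambda>x. norm (v x)"])
    show "integrable lebesgue (\<lambda>x. norm (v x))" using v by (rule integrable_norm)
    show "AE x in lebesgue. ((\<lambda>t. indicator {-t..b} x *\<^sub>R v x) \<longlongrightarrow> indicator {..b} x *\<^sub>R v x) at_top"
    proof (rule AE_I2)
      fix x
      have "\<forall>\<^sub>F t in at_top. indicator {..b} x *\<^sub>R v x = indicator {-t..b} x *\<^sub>R v x"
        using eventually_ge_at_top[of "-x"] by eventually_elim (auto simp: indicator_def)
      then show "((\<lambda>t. indicator {-t..b} x *\<^sub>R v x) \<longlongrightarrow> indicator {..b} x *\<^sub>R v x) at_top"
        by (rule Lim_transform_eventually[OF tendsto_const])
    qed
    show "\<forall>\<^sub>F t in at_top. AE x in lebesgue. norm (indicator {-t..b} x *\<^sub>R v x) \<le> norm (v x)"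
      by (auto simp: indicator_def)
  qed (auto intro!: borel_measurable_scaleR borel_measurable_indicator borel_measurable_integrable[OF v])
  then have "((\<lambda>t. u b - (LINT x|lebesgue. indicator {-t..b} x *\<^sub>R v x)) \<longlongrightarrow> u b - (LINT x|lebesgue. indicator {..b} x *\<^sub>R v x)) at_top"
    by (intro tendsto_intros)
  moreover have "\<forall>\<^sub>F t in at_top. u b - (LINT x|lebesgue. indicator {-t..b} x *\<^sub>R v x) = u (-t)"
    using eventually_ge_at_top[of "-b"]
  proof eventually_elim
    case (elim t)
    then show ?case
      using set_lebesgue_integral_eq_integral(2)[OF has_ac_derivD(1)[OF uv, of "-t" b]] has_ac_derivD(2)[OF uv, of "-t" b]
      by (simp add: set_lebesgue_integral_def)
  qed
  ultimately have "((\<lambda>t. u (-t)) \<longlongrightarrow> u b - (LINT x|lebesgue. indicator {..b} x *\<^sub>R v x)) at_top"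
    by (rule Lim_transform_eventually)
  then show ?thesis by (simp add: filterlim_at_bot_mirror)
qed

text \<open>The first conclusion turns a point value, such as the value at a node, into an integral
  of \<open>v\<close> over a half-line. The second, applied to a product, is integration by parts on
  the whole line without boundary terms.\<close>

lemma vanishing_ac_deriv:
  assumes uv: "has_ac_deriv u v" and v: "integrable lebesgue v"
    and "(u \<longlongrightarrow> 0) at_top" "(u \<longlongrightarrow> 0) at_bot"
  shows "(LINT x|lebesgue. indicator {..b} x *\<^sub>R v x) = u b" "integral\<^sup>L lebesgue v = 0"
proof -
  have top: "u a + (LINT x|lebesgue. indicator {a..} x *\<^sub>R v x) = 0" for a
    using tendsto_unique[OF _ has_ac_deriv_tendsto_at_top[OF uv v] assms(3)] by simp
  have bot: "u b - (LINT x|lebesgue. indicator {..b} x *\<^sub>R v x) = 0" for b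
    using tendsto_unique[OF _ has_ac_deriv_tendsto_at_bot[OF uv v] assms(4)] by simp
  then show "(LINT x|lebesgue. indicator {..b} x *\<^sub>R v x) = u b" by simp
  have int: "integrable lebesgue (\<lambda>x. indicator A x *\<^sub>R v x)" if "A \<in> sets lebesgue" for A
    using v that by (simp add: integrable_mult_indicator)
  \<comment> \<open>The two closed half-lines overlap in the point 0, which has to be discarded as a
    null set.\<close>
  have "AE x in lebesgue. x \<noteq> (0::real)"
    by (rule AE_completion) (rule AE_lborel_singleton)
  then have "integral\<^sup>L lebesgue v = (LINT x|lebesgue. indicator {..0} x *\<^sub>R v x + indicator {0..} x *\<^sub>R v x)"
  proof (intro integral_cong_AE)
    show "AE x in lebesgue. x \<noteq> (0::real) \<Longrightarrow> AE x in lebesgue. v x = indicator {..0} x *\<^sub>R v x + indicator {0..} x *\<^sub>R v x"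
      by (elim eventually_mono) (auto simp: indicator_def)
  qed (use v int in \<open>auto intro!: borel_measurable_add borel_measurable_integrable\<close>)
  also have "\<dots> = u 0 + - u 0"
    using top[of 0] bot[of 0] int by (simp add: eq_neg_iff_add_eq_0 add.commute)
  finally show "integral\<^sup>L lebesgue v = 0" by simp
qed

text \<open>A nonzero limit would force \<open>W x\<close> to be at least a positive multiple of 1/x
  far out, and the integral of 1/x diverges logarithmically.\<close>

lemma limit_zero_at_top:
  fixes G :: "real \<Rightarrow> 'a::real_normed_vector"
  assumes lim: "(G \<longlongrightarrow> L) at_top" and W: "integrable lebesgue W" and "\<And>x. 0 \<le> W x"
    and le: "\<And>x. norm (G x) powr p \<le> C * (1 + \<bar>x\<bar>) * W x" and p: "p > 0" and C: "C > 0"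
  shows "L = 0"
proof (rule ccontr)
  assume L: "L \<noteq> 0"
  have "\<forall>\<^sub>F x in at_top. norm L / 2 < norm (G x)"
    by (rule order_tendstoD(1)[OF tendsto_norm[OF lim]]) (use L in auto)
  then obtain R0 where R0: "\<And>x. x \<ge> R0 \<Longrightarrow> norm L / 2 < norm (G x)"
    by (auto simp: eventually_at_top_linorder)
  define R where "R = max 1 R0"
  \<comment> \<open>Beyond \<open>R\<close> the norm of \<open>G x\<close> exceeds half that of
    \<open>L\<close>, and 1 + x <= 2 x because x >= 1. Together these give
    \<open>d * (1 / x) \<le> W x\<close>.\<close>
  define d where "d = (norm L / 2) powr p / (2 * C)"
  have d: "d > 0" using L C by (simp add: d_def)
  have bound: "d * (1 / x) \<le> W x" if "x \<ge> R" for x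
  proof -
    have x: "x \<ge> 1" "x \<ge> R0" using that by (auto simp: R_def)
    have "(norm L / 2) powr p \<le> norm (G x) powr p"
      using R0[OF x(2)] p by (intro powr_mono2) auto
    also have "\<dots> \<le> C * (1 + \<bar>x\<bar>) * W x" by (rule le)
    also have "\<dots> \<le> C * (2 * x) * W x"
      using x C assms(3)[of x] by (intro mult_right_mono mult_left_mono) auto
    finally show ?thesis using C x by (simp add: d_def field_simps)
  qed
  \<comment> \<open>Chosen so that the integral of d/x over \<open>{R..S}\<close> exceeds the whole
    integral of \<open>W\<close> by exactly 1.\<close>
  define S where "S = R * exp ((integral\<^sup>L lebesgue W + 1) / d)"
  have W0: "0 \<le> integral\<^sup>L lebesgue W" by (rule integral_nonneg_AE) (use assms(3) in auto)
  have R: "R \<ge> 1" by (simp add: R_def)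
  moreover have "R * 1 \<le> R * exp ((integral\<^sup>L lebesgue W + 1) / d)"
    using d W0 R by (intro mult_left_mono) auto
  ultimately have "R \<le> S" by (simp add: S_def)
  have "((\<lambda>x. d * (1 / x)) has_integral (d * ln S - d * ln R)) {R..S}"
    using R \<open>R \<le> S\<close> by (intro fundamental_theorem_of_calculus)
       (auto intro!: derivative_eq_intros simp: has_real_derivative_iff_has_vector_derivative[symmetric])
  then have "d * ln S - d * ln R = integral {R..S} (\<lambda>x. d * (1 / x))"
    by (simp add: integral_unique)
  also have "\<dots> \<le> integral {R..S} W"
    using \<open>((\<lambda>x. d * (1 / x)) has_integral _) _\<close> bound integrable_on_lebesgue[OF W]
    by (intro integral_le) (auto intro: integrable_on_subinterval)
  also have "\<dots> \<le> integral UNIV W"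
    using integrable_on_lebesgue[OF W] assms(3)
    by (intro integral_subset_le) (auto intro: integrable_on_subinterval)
  also have "\<dots> = integral\<^sup>L lebesgue W"
    using W by (rule integral_lebesgue)
  finally have "d * ln S - d * ln R \<le> integral\<^sup>L lebesgue W" .
  moreover
  have "ln S = ln R + (integral\<^sup>L lebesgue W + 1) / d"
    using R by (simp add: S_def ln_mult)
  then have "d * ln S - d * ln R = integral\<^sup>L lebesgue W + 1"
    using d by (simp add: field_simps)
  ultimately show False by simp
qed

lemma limit_zero_at_bot:
  fixes G :: "real \<Rightarrow> 'a::real_normed_vector"
  assumes lim: "(G \<longlongrightarrow> L) at_bot" and W: "integrable lebesgue W" and "\<And>x. 0 \<le> W x"
    and le: "\<And>x. norm (G x) powr p \<le> C * (1 + \<bar>x\<bar>) * W x" and p: "p > 0" and C: "C > 0"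
  shows "L = 0"
proof (rule limit_zero_at_top[of "\<lambda>x. G (-x)" L "\<lambda>x. W (-x)" p C])
  show "((\<lambda>x. G (-x)) \<longlongrightarrow> L) at_top" using lim by (simp add: filterlim_at_bot_mirror)
  show "integrable lebesgue (\<lambda>x. W (-x))"
    using W lebesgue_integrable_real_affine[of W "-1" 0] by simp
  show "norm (G (-x)) powr p \<le> C * (1 + \<bar>x\<bar>) * W (-x)" for x using le[of "-x"] by simp
qed (use assms in auto)

text \<open>For y > l the factor y^(1-p) is at most l^(1-p), since 1 - p <= 0. The scale
  \<open>l\<close> stays free so that both terms can later be balanced.\<close>

lemma le_add_powr:
  fixes y l p :: real
  assumes "y \<ge> 0" "l > 0" "p \<ge> 1"
  shows "y \<le> l + l powr (1 - p) * y powr p"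
proof (cases "y \<le> l")
  case False
  then have "y = y powr (1 - p) * y powr p" using assms by (simp add: powr_add[symmetric])
  also have "\<dots> \<le> l powr (1 - p) * y powr p"
    using False assms by (intro mult_right_mono powr_mono2') auto
  finally show ?thesis using assms by simp
qed (use assms in \<open>auto intro: add_increasing2\<close>)

section \<open>Pulling back to the line\<close>

lemma poly_abs_le:
  fixes N :: "real poly"
  assumes "degree N \<le> d"
  obtains A where "A > 0" "\<And>x. \<bar>poly N x\<bar> \<le> A * (1 + \<bar>x\<bar>) ^ d"
proof (rule that)
  let ?A = "1 + (\<Sum>i\<le>degree N. \<bar>coeff N i\<bar>)"
  show "?A > 0" by (intro add_pos_nonneg sum_nonneg) auto
  fix x :: real
  have "\<bar>poly N x\<bar> \<le> (\<Sum>i\<le>degree N. \<bar>coeff N i * x ^ i\<bar>)"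
    unfolding poly_altdef by (rule sum_abs)
  also have "\<dots> \<le> (\<Sum>i\<le>degree N. \<bar>coeff N i\<bar> * (1 + \<bar>x\<bar>) ^ d)"
  proof (rule sum_mono)
    fix i assume "i \<in> {..degree N}"
    then have "\<bar>x\<bar> ^ i \<le> (1 + \<bar>x\<bar>) ^ i" "(1 + \<bar>x\<bar>) ^ i \<le> (1 + \<bar>x\<bar>) ^ d"
      using assms by (auto intro!: power_mono power_increasing)
    then show "\<bar>coeff N i * x ^ i\<bar> \<le> \<bar>coeff N i\<bar> * (1 + \<bar>x\<bar>) ^ d"
      by (auto simp: abs_mult power_abs intro!: mult_left_mono)
  qed
  also have "\<dots> \<le> ?A * (1 + \<bar>x\<bar>) ^ d"
    by (simp add: sum_distrib_right[symmetric] distrib_right)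
  finally show "\<bar>poly N x\<bar> \<le> ?A * (1 + \<bar>x\<bar>) ^ d" .
qed

text \<open>Compactness on \<open>{-1..1}\<close> bounds q from below there. For larger |x| it is
  applied to the reflected polynomial at 1/x, which is nonzero at 0 because its value there is the
  leading coefficient of q.\<close>

lemma positive_poly_ge:
  fixes q :: "real poly"
  assumes pos: "\<And>x. poly q x > 0"
  obtains a where "a > 0" "\<And>x. a * (1 + \<bar>x\<bar>) ^ degree q \<le> poly q x"
proof -
  let ?d = "degree q"
  have min: "\<exists>a>0. \<forall>x\<in>{-1..1}. a \<le> \<bar>poly Q x\<bar>" if "\<And>x. poly Q x \<noteq> 0" for Q :: "real poly"
  proof -
    have "\<exists>z\<in>{-1..1}. \<forall>x\<in>{-1..1}. \<bar>poly Q z\<bar> \<le> \<bar>poly Q x\<bar>"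
      by (rule continuous_attains_inf) (auto intro!: continuous_intros)
    then show ?thesis using that by (metis zero_less_abs_iff)
  qed
  have "q \<noteq> 0" using pos[of 0] by auto
  have "poly (reflect_poly q) x \<noteq> 0" for x
  proof (cases "x = 0")
    case False
    then show ?thesis using pos[of "inverse x"] by (simp add: poly_reflect_poly_nz)
  qed (use \<open>q \<noteq> 0\<close> in \<open>simp add: poly_0_coeff_0\<close>)
  then obtain a where a: "a > 0" "\<And>x. x \<in> {-1..1} \<Longrightarrow> a \<le> \<bar>poly (reflect_poly q) x\<bar>"
    using min by blast
  obtain b where b: "b > 0" "\<And>x. x \<in> {-1..1} \<Longrightarrow> b \<le> \<bar>poly q x\<bar>"
    using min[of q] pos by (metis less_irrefl)
  \<comment> \<open>The power of 2 pays for 1 + |x| <= 2 on \<open>{-1..1}\<close> and 1 + |x| <= 2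
    |x| outside.\<close>
  define e where "e = min a b / 2 ^ ?d"
  have "e * (1 + \<bar>x\<bar>) ^ ?d \<le> poly q x" for x
  proof (cases "\<bar>x\<bar> \<le> 1")
    case True
    have "e * (1 + \<bar>x\<bar>) ^ ?d \<le> e * 2 ^ ?d"
      using True a b by (intro mult_left_mono power_mono) (auto simp: e_def)
    also have "\<dots> \<le> \<bar>poly q x\<bar>" using b(2)[of x] True by (auto simp: e_def abs_le_iff)
    finally show ?thesis using pos[of x] by simp
  next
    case False
    have "e * (1 + \<bar>x\<bar>) ^ ?d \<le> e * (2 * \<bar>x\<bar>) ^ ?d"
      using False a b by (intro mult_left_mono power_mono) (auto simp: e_def)
    also have "\<dots> \<le> a * \<bar>x\<bar> ^ ?d"
      using False by (auto simp: e_def power_mult_distrib intro!: mult_right_mono)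
    also have "\<dots> \<le> \<bar>poly (reflect_poly q) (inverse x)\<bar> * \<bar>x\<bar> ^ ?d"
      using False by (intro mult_right_mono a(2)) (auto simp: abs_le_iff divide_simps)
    also have "\<dots> = poly q x"
      using False pos[of x] by (simp add: poly_reflect_poly_nz abs_mult power_abs power_inverse[symmetric] flip: power_mult_distrib)
    finally show ?thesis .
  qed
  moreover have "e > 0" using a b by (simp add: e_def)
  ultimately show ?thesis using that by blast
qed

text \<open>The sum is at most \<open>card I\<close> times its largest term, and the p-th power of
  that term occurs on the right.\<close>

lemma sum_powr_le:
  fixes a :: "'i \<Rightarrow> real"
  assumes "finite I" "\<And>i. i \<in> I \<Longrightarrow> a i \<ge> 0" "p \<ge> 0"
  shows "(\<Sum>i\<in>I. a i) powr p \<le> real (card I) powr p * (\<Sum>i\<in>I. a i powr p)"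
proof (cases "I = {}")
  case False
  then obtain k where k: "k \<in> I" "\<And>i. i \<in> I \<Longrightarrow> a i \<le> a k"
    using Max_in[of "a ` I"] Max_ge[of "a ` I"] assms(1) by (metis (no_types, lifting) finite_imageI imageE imageI image_is_empty)
  have "(\<Sum>i\<in>I. a i) \<le> real (card I) * a k"
    using sum_bounded_above[of I a "a k"] k by simp
  then have "(\<Sum>i\<in>I. a i) powr p \<le> (real (card I) * a k) powr p"
    using assms by (intro powr_mono2) (auto intro: sum_nonneg)
  also have "\<dots> = real (card I) powr p * a k powr p"
    using assms k by (simp add: powr_mult)
  also have "\<dots> \<le> real (card I) powr p * (\<Sum>i\<in>I. a i powr p)"
    using assms k by (intro mult_left_mono member_le_sum) auto
  finally show ?thesis .
qed simp

lemma borel_imp_lebesgue_measurable: "f \<in> borel_measurable borel \<Longrightarrow> f \<in> borel_measurable lebesgue"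
  by (simp add: measurable_completion)

lemma continuous_imp_lebesgue_measurable:
  "continuous_on UNIV f \<Longrightarrow> f \<in> borel_measurable lebesgue"
  by (intro borel_imp_lebesgue_measurable borel_measurable_continuous_onI)

lemma integrable_bounded_scaleR:
  fixes v :: "real \<Rightarrow> 'a::euclidean_space"
  assumes "integrable lebesgue v" "K \<in> borel_measurable lebesgue" "\<And>x. \<bar>K x\<bar> \<le> M"
  shows "integrable lebesgue (\<lambda>x. K x *\<^sub>R v x)"
proof (rule Bochner_Integration.integrable_bound)
  show "integrable lebesgue (\<lambda>x. M * norm (v x))" using assms(1) by simp
  show "(\<lambda>x. K x *\<^sub>R v x) \<in> borel_measurable lebesgue"
    using assms(1,2) by (intro borel_measurable_scaleR) auto
  show "AE x in lebesgue. norm (K x *\<^sub>R v x) \<le> norm (M * norm (v x))"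
    using assms(3) by (auto intro!: AE_I2 mult_right_mono simp: abs_mult intro: order_trans[OF _ abs_ge_self])
qed

lemma tendsto_bounded_scaleR_zero:
  fixes G :: "real \<Rightarrow> 'a::real_normed_vector"
  assumes "(G \<longlongrightarrow> 0) F" "\<And>x. \<bar>K x\<bar> \<le> M"
  shows "((\<lambda>x. K x *\<^sub>R G x) \<longlongrightarrow> 0) F"
proof (rule Lim_null_comparison)
  show "\<forall>\<^sub>F x in F. norm (K x *\<^sub>R G x) \<le> M * norm (G x)"
    using assms(2) by (auto intro!: always_eventually mult_right_mono)
  show "((\<lambda>x. M * norm (G x)) \<longlongrightarrow> 0) F"
    using tendsto_mult[OF tendsto_const tendsto_norm[OF assms(1)], of M] by simp
qed

section \<open>The change of variables between the angle and the line\<close>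

locale moebius_rule =
  fixes q :: "real poly" and m :: nat and \<gamma> \<upsilon> p :: real and \<alpha> :: nat
  assumes m: "m \<ge> 1" and degree_q: "degree q = 2 * m" and q_pos: "poly q x > 0"
    and gamma: "\<gamma> > 0" and p: "1 < p" and alpha: "\<alpha> \<ge> 1"
begin

definition jac :: "real \<Rightarrow> real" where
  "jac x = (\<gamma>\<^sup>2 + x\<^sup>2) / (2 * \<gamma>)"

definition angle :: "real \<Rightarrow> real" where
  "angle x = pi + 2 * arctan (x / \<gamma>)"

lemma jac_pos: "jac x > 0"
  using gamma by (auto simp: jac_def intro!: divide_pos_pos add_pos_nonneg)

lemma continuous_jac: "continuous_on A jac"
  unfolding jac_def[abs_def] using gamma by (intro continuous_intros) auto

lemma DERIV_angle: "(angle has_real_derivative 1 / jac x) (at x)"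
proof -
  have "\<gamma>\<^sup>2 + x\<^sup>2 > 0" using gamma by (intro add_pos_nonneg) auto
  then show ?thesis
    unfolding angle_def[abs_def] jac_def using gamma
    by (auto intro!: derivative_eq_intros simp: power_divide divide_simps) (simp add: power2_eq_square algebra_simps)
qed

lemma angle_bounds: "0 < angle x" "angle x < 2 * pi"
  using arctan_bounded[of "x / \<gamma>"] by (auto simp: angle_def)

lemma angle_le_iff: "angle x \<le> angle y \<longleftrightarrow> x \<le> y"
  using gamma by (simp add: angle_def arctan_le_iff divide_le_cancel)

lemma continuous_angle: "continuous_on A angle"
  by (meson DERIV_angle DERIV_isCont continuous_at_imp_continuous_on)

lemma has_ac_deriv_angle: "has_ac_deriv angle (\<lambda>x. 1 / jac x)"
  by (rule has_ac_deriv_C1)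
     (use DERIV_angle jac_pos in \<open>auto simp: has_real_derivative_iff_has_vector_derivative less_imp_neq[symmetric]
       intro!: continuous_intros continuous_jac\<close>)

text \<open>The function -cot(\<theta>/2) is tan(\<theta>/2 - pi/2), and on (0, 2 pi) this argument
  lies in the principal branch of arctan. The identity 1/sin^2 = 1 + cot^2 turns the derivative of
  \<open>phi\<close> into a quadratic polynomial in x.\<close>

lemma angle_phi:
  assumes "0 < \<theta>" "\<theta> < 2 * pi"
  shows "angle (phi \<gamma> \<theta>) = \<theta>" "deriv (phi \<gamma>) \<theta> = jac (phi \<gamma> \<theta>)"
proof -
  have s: "sin (\<theta> / 2) > 0" using assms by (intro sin_gt_zero) auto
  have "tan (\<theta> / 2 - pi / 2) = - cot (\<theta> / 2)"
    using s by (simp add: tan_def cot_def sin_diff cos_diff)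
  then have "arctan (- cot (\<theta> / 2)) = \<theta> / 2 - pi / 2"
    using assms by (intro arctan_unique) auto
  then show "angle (phi \<gamma> \<theta>) = \<theta>"
    using gamma by (simp add: angle_def phi_def)
  have "(phi \<gamma> has_real_derivative \<gamma> / (2 * (sin (\<theta> / 2))\<^sup>2)) (at \<theta>)"
    unfolding phi_def[abs_def] using s
    by (auto intro!: derivative_eq_intros DERIV_cot[THEN DERIV_chain2] simp: divide_simps)
  moreover have "\<gamma> / (2 * (sin (\<theta> / 2))\<^sup>2) = jac (phi \<gamma> \<theta>)"
  proof -
    have "(cot (\<theta> / 2))\<^sup>2 = 1 / (sin (\<theta> / 2))\<^sup>2 - 1"
      using s by (simp add: cot_def power_divide cos_squared_eq diff_divide_distrib)
    then have "\<gamma>\<^sup>2 + (phi \<gamma> \<theta>)\<^sup>2 = \<gamma>\<^sup>2 * (1 / (sin (\<theta> / 2))\<^sup>2)"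
      by (simp add: phi_def power_mult_distrib right_diff_distrib)
    then show ?thesis using gamma by (simp add: jac_def power2_eq_square)
  qed
  ultimately show "deriv (phi \<gamma>) \<theta> = jac (phi \<gamma> \<theta>)"
    by (simp add: DERIV_imp_deriv)
qed

text \<open>\<open>1 / jac x\<close> is the density of d\<theta> on the line, so its total mass is
  the length of (0, 2 pi).\<close>

lemma integrable_inverse_jac: "integrable lebesgue (\<lambda>x. 1 / jac x)"
  and LINT_inverse_jac: "(LINT x|lebesgue. 1 / jac x) = 2 * pi"
proof -
  have cont: "isCont (\<lambda>x. 1 / jac x) x" for x
    using continuous_jac[of UNIV] jac_pos[of x]
    by (intro continuous_intros) (auto simp: continuous_on_eq_continuous_at)
  have lim: "((angle \<circ> real_of_ereal) \<longlongrightarrow> 0) (at_right (-\<infinity>))" "((angle \<circ> real_of_ereal) \<longlongrightarrow> 2 * pi) (at_left \<infinity>)"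
  proof -
    have "filterlim (\<lambda>x. x / \<gamma>) at_top at_top"
      using filterlim_tendsto_pos_mult_at_top[OF tendsto_const _ filterlim_ident, of "inverse \<gamma>"] gamma
      by (simp add: divide_inverse mult.commute)
    then have "((\<lambda>x. pi + 2 * arctan (x / \<gamma>)) \<longlongrightarrow> pi + 2 * (pi / 2)) at_top"
      by (intro tendsto_intros filterlim_compose[OF tendsto_arctan_at_top])
    then have "(angle \<longlongrightarrow> 2 * pi) at_top" by (simp add: angle_def[abs_def])
    then show "((angle \<circ> real_of_ereal) \<longlongrightarrow> 2 * pi) (at_left \<infinity>)"
      by (simp add: ereal_tendsto_simps1)
    have "filterlim (\<lambda>x. x / \<gamma>) at_bot at_bot"
      using filterlim_tendsto_pos_mult_at_bot[OF tendsto_const _ filterlim_ident, of "inverse \<gamma>"] gamma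
      by (simp add: divide_inverse mult.commute)
    then have "((\<lambda>x. pi + 2 * arctan (x / \<gamma>)) \<longlongrightarrow> pi + 2 * (- (pi / 2))) at_bot"
      by (intro tendsto_intros filterlim_compose[OF tendsto_arctan_at_bot])
    then have "(angle \<longlongrightarrow> 0) at_bot" by (simp add: angle_def[abs_def])
    then show "((angle \<circ> real_of_ereal) \<longlongrightarrow> 0) (at_right (-\<infinity>))"
      by (simp add: ereal_tendsto_simps1)
  qed
  have 1: "set_integrable lborel (einterval (-\<infinity>) \<infinity>) (\<lambda>x. 1 / jac x)"
    by (rule interval_integral_FTC_nonneg(1)[OF _ DERIV_angle cont _ lim]) (use jac_pos in \<open>auto intro!: AE_I2 less_imp_le\<close>)
  have 2: "(LBINT x=-\<infinity>..\<infinity>. 1 / jac x) = 2 * pi - 0"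
    by (rule interval_integral_FTC_nonneg(2)[OF _ DERIV_angle cont _ lim]) (use jac_pos in \<open>auto intro!: AE_I2 less_imp_le\<close>)
  have meas: "(\<lambda>x. 1 / jac x) \<in> borel_measurable lborel"
    using cont by (auto intro!: borel_measurable_continuous_onI simp: continuous_on_eq_continuous_at)
  show "integrable lebesgue (\<lambda>x. 1 / jac x)"
    using 1 meas by (simp add: set_integrable_def integrable_completion)
  show "(LINT x|lebesgue. 1 / jac x) = 2 * pi"
    using 2 meas by (simp add: interval_lebesgue_integral_def set_lebesgue_integral_def integral_completion)
qed

lemma inverse_jac_le:
  obtains D where "D > 0" "\<And>x. 1 / jac x \<le> D * (1 + \<bar>x\<bar>) powr (-2)"
proof (rule that)
  \<comment> \<open>Product of the constants in (1 + |x|)^2 <= 2 (1 + x^2), in 1 + x^2 <= (1 +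
    1/\<gamma>^2) (\<gamma>^2 + x^2) and in \<gamma>^2 + x^2 = 2 \<gamma> jac x.\<close>
  let ?D = "4 * \<gamma> * (1 + 1 / \<gamma>\<^sup>2)"
  show "?D > 0" using gamma by (intro mult_pos_pos add_pos_nonneg) auto
  fix x :: real
  have "(1 + \<bar>x\<bar>)\<^sup>2 + (1 - \<bar>x\<bar>)\<^sup>2 = 2 * (1 + x\<^sup>2)" by (simp add: power2_eq_square algebra_simps)
  then have "(1 + \<bar>x\<bar>)\<^sup>2 \<le> 2 * (1 + x\<^sup>2)" by (smt (verit) zero_le_power2)
  also have "\<dots> \<le> 2 * ((1 + 1 / \<gamma>\<^sup>2) * (\<gamma>\<^sup>2 + x\<^sup>2))"
    using gamma by (simp add: field_simps)
  also have "\<dots> = ?D * jac x" using gamma by (simp add: jac_def)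
  finally have "(1 + \<bar>x\<bar>)\<^sup>2 \<le> ?D * jac x" .
  then show "1 / jac x \<le> ?D * (1 + \<bar>x\<bar>) powr (-2)"
    using jac_pos[of x] by (simp add: powr_minus powr_numeral field_simps)
qed

section \<open>Two-sided bounds for the weights by powers of 1 + |x|\<close>

lemma q_powr_le:
  obtains A where "A > 0" "\<And>x. poly q x powr s \<le> A * (1 + \<bar>x\<bar>) powr (2 * real m * s)"
proof -
  have eq: "(c * (1 + \<bar>x\<bar>) ^ (2 * m)) powr s = c powr s * (1 + \<bar>x\<bar>) powr (2 * real m * s)" if "c > 0" for c x :: real
  proof -
    have "(1 + \<bar>x\<bar>) ^ (2 * m) = (1 + \<bar>x\<bar>) powr (2 * real m)" by (subst powr_realpow[symmetric]) auto
    then show ?thesis using that by (simp add: powr_mult powr_powr)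
  qed
  show ?thesis
  \<comment> \<open>A nonnegative power needs q bounded from above, a negative one needs it bounded
    from below, where positivity of q enters.\<close>
  proof (cases "s \<ge> 0")
    case True
    obtain A where A: "A > 0" "\<And>x. \<bar>poly q x\<bar> \<le> A * (1 + \<bar>x\<bar>) ^ (2 * m)"
      using poly_abs_le[of q "2 * m"] degree_q by auto
    have "poly q x powr s \<le> (A * (1 + \<bar>x\<bar>) ^ (2 * m)) powr s" for x
      using True q_pos[of x] A(2)[of x] by (intro powr_mono2) auto
    then show ?thesis using that[of "A powr s"] A(1) eq[OF A(1)] by simp
  next
    case False
    obtain a where a: "a > 0" "\<And>x. a * (1 + \<bar>x\<bar>) ^ (2 * m) \<le> poly q x"
      using positive_poly_ge[of q] degree_q q_pos by metis
    have "poly q x powr s \<le> (a * (1 + \<bar>x\<bar>) ^ (2 * m)) powr s" for x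
      using False a by (intro powr_mono2') (auto intro!: mult_pos_pos)
    then show ?thesis using that[of "a powr s"] a(1) eq[OF a(1)] by simp
  qed
qed

lemma rho_le:
  obtains A where "A > 0" "\<And>x. rho q m \<kappa> x \<le> A * (1 + \<bar>x\<bar>) powr (- \<kappa>)"
  using q_powr_le[of "- \<kappa> / (2 * real m)"] m by (auto simp: rho_def)

text \<open>The weights for \<open>\<kappa>\<close> and \<open>-\<kappa>\<close> are reciprocal, so
  a lower bound for one is an upper bound for the other.\<close>

lemma rho_ge:
  obtains A where "A > 0" "\<And>x. (1 + \<bar>x\<bar>) powr (- \<kappa>) \<le> A * rho q m \<kappa> x"
proof -
  obtain A where A: "A > 0" "\<And>x. rho q m (- \<kappa>) x \<le> A * (1 + \<bar>x\<bar>) powr \<kappa>"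
    using rho_le[of "-\<kappa>"] by auto
  have "(1 + \<bar>x\<bar>) powr (- \<kappa>) \<le> A * rho q m \<kappa> x" for x
    using A(2)[of x] q_pos[of x] by (simp add: rho_def powr_minus field_simps)
  then show ?thesis using that A(1) by blast
qed

text \<open>With \<open>x = \<phi>(\<theta>)\<close> the \<open>\<tau>\<close>-th derivative in \<open>\<theta>\<close> of \<open>f(x) \<rho>(x) \<phi>'(\<theta>)\<close> is
  \<open>(jac d/dx)^\<tau> (f \<rho> jac) = \<Sum>\<^sub>\<sigma> weight \<tau> \<sigma> f\<^sup>(\<^sup>\<sigma>\<^sup>)\<close>; each coefficient is \<open>\<rho> / q^\<tau>\<close> times a polynomial.\<close>

definition jac_poly :: "real poly" where
  "jac_poly = [:\<gamma> / 2, 0, 1 / (2 * \<gamma>):]"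

lemma poly_jac_poly: "poly jac_poly x = jac x"
  using gamma by (simp add: jac_poly_def jac_def power2_eq_square field_simps)

text \<open>The numerator of the derivative of \<rho> N / q^\<tau> over the denominator
  q^(\<tau>+1). The contribution \<upsilon>/(2m) comes from \<rho>' = -(\<upsilon>/(2m)) \<rho>
  q'/q, the contribution \<tau> from the denominator.\<close>

definition numer_deriv :: "nat \<Rightarrow> real poly \<Rightarrow> real poly" where
  "numer_deriv \<tau> N = q * pderiv N - smult (\<upsilon> / (2 * real m) + real \<tau>) (pderiv q * N)"

text \<open>The first summand differentiates the coefficient. The second moves the derivative onto
  f, which raises \<sigma>; its factor q brings it to the common denominator q^(\<tau>+1).\<close>

fun numer :: "nat \<Rightarrow> nat \<Rightarrow> real poly" where
  "numer 0 \<sigma> = (if \<sigma> = 0 then jac_poly else 0)"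
| "numer (Suc \<tau>) \<sigma> = jac_poly * numer_deriv \<tau> (numer \<tau> \<sigma>) +
     (case \<sigma> of 0 \<Rightarrow> 0 | Suc \<mu> \<Rightarrow> jac_poly * q * numer \<tau> \<mu>)"

lemma numer_eq_0: "\<tau> < \<sigma> \<Longrightarrow> numer \<tau> \<sigma> = 0"
  by (induction \<tau> arbitrary: \<sigma>) (auto simp: numer_deriv_def split: nat.split)

text \<open>One step multiplies by \<open>jac_poly\<close> and by one factor of degree 2 m.
  Differentiating the coefficient loses one degree; moving the derivative onto f loses none but
  raises \<sigma> by one. Both therefore fit the same bound.\<close>

lemma degree_numer: "degree (numer \<tau> \<sigma>) \<le> 2 + \<tau> + \<sigma> + 2 * m * \<tau>"
proof (induction \<tau> arbitrary: \<sigma>)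
  case 0
  then show ?case by (simp add: jac_poly_def)
next
  case (Suc \<tau>)
  let ?N = "numer \<tau> \<sigma>" and ?k = "2 + Suc \<tau> + \<sigma> + 2 * m * Suc \<tau>"
  have J: "degree jac_poly \<le> 2" by (simp add: jac_poly_def)
  have "degree (q * pderiv ?N) \<le> 2 * m + (1 + \<tau> + \<sigma> + 2 * m * \<tau>)"
    using Suc.IH[of \<sigma>] degree_mult_le[of q "pderiv ?N"] by (simp add: degree_q degree_pderiv)
  moreover have "degree (pderiv q * ?N) \<le> (2 * m - 1) + (2 + \<tau> + \<sigma> + 2 * m * \<tau>)"
    using Suc.IH[of \<sigma>] degree_mult_le[of "pderiv q" ?N] by (simp add: degree_q degree_pderiv)
  ultimately have "degree (numer_deriv \<tau> ?N) \<le> 2 * m + (1 + \<tau> + \<sigma> + 2 * m * \<tau>)"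
    unfolding numer_deriv_def using m
    by (intro degree_diff_le order_trans[OF degree_smult_le]) linarith+
  then have "degree (jac_poly * numer_deriv \<tau> ?N) \<le> ?k"
    using J degree_mult_le[of jac_poly "numer_deriv \<tau> ?N"] by simp
  moreover have "degree (case \<sigma> of 0 \<Rightarrow> 0 | Suc \<mu> \<Rightarrow> jac_poly * q * numer \<tau> \<mu>) \<le> ?k"
  proof (cases \<sigma>)
    case (Suc \<mu>)
    have "degree (jac_poly * q) \<le> 2 + 2 * m"
      using J degree_mult_le[of jac_poly q] by (simp add: degree_q)
    then show ?thesis
      using Suc Suc.IH[of \<mu>] degree_mult_le[of "jac_poly * q" "numer \<tau> \<mu>"] by simp
  qed simp
  ultimately show ?case unfolding numer.simps by (rule degree_add_le)
qed

definition weight :: "nat \<Rightarrow> nat \<Rightarrow> real \<Rightarrow> real" where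
  "weight \<tau> \<sigma> x = rho q m \<upsilon> x * poly (numer \<tau> \<sigma>) x / poly q x ^ \<tau>"

definition weight_deriv :: "nat \<Rightarrow> nat \<Rightarrow> real \<Rightarrow> real" where
  "weight_deriv \<tau> \<sigma> x = rho q m \<upsilon> x * poly (numer_deriv \<tau> (numer \<tau> \<sigma>)) x / poly q x ^ Suc \<tau>"

lemma q_neq_0 [simp]: "poly q x \<noteq> 0"
  using q_pos[of x] by simp

lemma DERIV_rho:
  "(rho q m \<kappa> has_real_derivative - \<kappa> / (2 * real m) * rho q m \<kappa> x * poly (pderiv q) x / poly q x) (at x)"
  unfolding rho_def[abs_def] using q_pos[of x]
  by (auto intro!: derivative_eq_intros has_real_derivative_powr[THEN DERIV_chain2] poly_DERIV
      simp: powr_diff field_simps)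

lemma continuous_rho: "continuous_on A (rho q m \<kappa>)"
  by (meson DERIV_rho DERIV_isCont continuous_at_imp_continuous_on)

lemma DERIV_weight: "(weight \<tau> \<sigma> has_real_derivative weight_deriv \<tau> \<sigma> x) (at x)"
proof -
  let ?N = "numer \<tau> \<sigma>" and ?k = "\<upsilon> / (2 * real m)"
  let ?r = "rho q m \<upsilon> x" and ?q = "poly q x" and ?q' = "poly (pderiv q) x"
  let ?n = "poly ?N x" and ?n' = "poly (pderiv ?N) x"
  have D: "(weight \<tau> \<sigma> has_real_derivative
     ((- ?k * ?r * ?q' / ?q) * ?n + ?r * ?n') / ?q ^ \<tau> - ?r * ?n * (real \<tau> * ?q ^ (\<tau> - 1) * ?q') / (?q ^ \<tau> * ?q ^ \<tau>)) (at x)"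
    unfolding weight_def[abs_def]
    by (auto intro!: derivative_eq_intros DERIV_rho poly_DERIV simp: field_simps)
  \<comment> \<open>Eliminates the truncated exponent \<open>\<tau> - 1\<close>: for
    \<open>\<tau> = 0\<close> both sides are 0.\<close>
  have pw: "real \<tau> * ?q ^ (\<tau> - 1) = real \<tau> * ?q ^ \<tau> / ?q"
    by (cases \<tau>) auto
  have "((- ?k * ?r * ?q' / ?q) * ?n + ?r * ?n') / ?q ^ \<tau> - ?r * ?n * (real \<tau> * ?q ^ (\<tau> - 1) * ?q') / (?q ^ \<tau> * ?q ^ \<tau>)
      = weight_deriv \<tau> \<sigma> x"
    unfolding pw weight_deriv_def numer_deriv_def
    by (simp add: divide_simps) (simp add: algebra_simps)
  with D show ?thesis by simp
qed

lemma continuous_weight: "continuous_on A (weight \<tau> \<sigma>)"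
  by (meson DERIV_weight DERIV_isCont continuous_at_imp_continuous_on)

lemma has_ac_deriv_weight: "has_ac_deriv (weight \<tau> \<sigma>) (weight_deriv \<tau> \<sigma>)"
proof (rule has_ac_deriv_C1)
  show "continuous_on UNIV (weight_deriv \<tau> \<sigma>)"
    unfolding weight_deriv_def[abs_def] by (intro continuous_intros continuous_rho) auto
qed (use DERIV_weight in \<open>auto simp: has_real_derivative_iff_has_vector_derivative\<close>)

lemma weight_0_0: "weight 0 0 x = rho q m \<upsilon> x * jac x"
  by (simp add: weight_def poly_jac_poly)

lemma weight_Suc:
  "weight (Suc \<tau>) \<sigma> x = jac x * (weight_deriv \<tau> \<sigma> x + (case \<sigma> of 0 \<Rightarrow> 0 | Suc \<mu> \<Rightarrow> weight \<tau> \<mu> x))"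
  by (cases \<sigma>) (auto simp: weight_def weight_deriv_def poly_jac_poly field_simps)

lemma weight_deriv_eq_0: "\<tau> < \<sigma> \<Longrightarrow> weight_deriv \<tau> \<sigma> x = 0"
  by (simp add: weight_deriv_def numer_deriv_def numer_eq_0)

text \<open>The exponent adds -\<upsilon> from the weight, the degree of the numerator and -2 m
  \<tau> from the denominator; m cancels.\<close>

lemma weight_le:
  obtains C where "C > 0" "\<And>x. \<bar>weight \<tau> \<sigma> x\<bar> \<le> C * (1 + \<bar>x\<bar>) powr (2 - \<upsilon> + real \<tau> + real \<sigma>)"
proof -
  obtain A where A: "A > 0" "\<And>x. rho q m \<upsilon> x \<le> A * (1 + \<bar>x\<bar>) powr (- \<upsilon>)"
    using rho_le[of \<upsilon>] by blast
  obtain B where B: "B > 0" "\<And>x. \<bar>poly (numer \<tau> \<sigma>) x\<bar> \<le> B * (1 + \<bar>x\<bar>) ^ (2 + \<tau> + \<sigma> + 2 * m * \<tau>)"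
    using poly_abs_le[OF degree_numer] by blast
  obtain D where D: "D > 0" "\<And>x. poly q x powr (- real \<tau>) \<le> D * (1 + \<bar>x\<bar>) powr (2 * real m * - real \<tau>)"
    using q_powr_le[of "- real \<tau>"] by blast
  have "\<bar>weight \<tau> \<sigma> x\<bar> \<le> A * B * D * (1 + \<bar>x\<bar>) powr (2 - \<upsilon> + real \<tau> + real \<sigma>)" for x
  proof -
    let ?y = "1 + \<bar>x\<bar>"
    have "poly q x powr (- real \<tau>) = 1 / poly q x ^ \<tau>"
      by (simp only: powr_minus powr_realpow[OF q_pos] inverse_eq_divide)
    then have "\<bar>weight \<tau> \<sigma> x\<bar> = rho q m \<upsilon> x * \<bar>poly (numer \<tau> \<sigma>) x\<bar> * poly q x powr (- real \<tau>)"
      using q_pos[of x] by (simp add: weight_def abs_mult rho_def power_abs)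
    also have "\<dots> \<le> (A * ?y powr (- \<upsilon>)) * (B * ?y ^ (2 + \<tau> + \<sigma> + 2 * m * \<tau>)) * (D * ?y powr (2 * real m * - real \<tau>))"
      by (intro mult_mono A(2) B(2) D(2) mult_nonneg_nonneg)
         (use A(1) B(1) D(1) in \<open>auto simp: rho_def\<close>)
    also have "?y ^ (2 + \<tau> + \<sigma> + 2 * m * \<tau>) = ?y powr (2 + real \<tau> + real \<sigma> + 2 * real m * real \<tau>)"
      by (subst powr_realpow[symmetric]) (auto simp: add.assoc)
    also have "(A * ?y powr (- \<upsilon>)) * (B * ?y powr (2 + real \<tau> + real \<sigma> + 2 * real m * real \<tau>)) * (D * ?y powr (2 * real m * - real \<tau>))
        = A * B * D * (?y powr (- \<upsilon>) * ?y powr (2 + real \<tau> + real \<sigma> + 2 * real m * real \<tau>) * ?y powr (2 * real m * - real \<tau>))"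
      by (simp only: mult_ac)
    also have "?y powr (- \<upsilon>) * ?y powr (2 + real \<tau> + real \<sigma> + 2 * real m * real \<tau>) * ?y powr (2 * real m * - real \<tau>)
        = ?y powr (2 - \<upsilon> + real \<tau> + real \<sigma>)"
      by (simp only: powr_add[symmetric]) (simp add: algebra_simps)
    finally show ?thesis .
  qed
  moreover have "A * B * D > 0" using A B D by simp
  ultimately show ?thesis using that by blast
qed

section \<open>Pointwise estimates for the transformed derivatives\<close>

definition transform :: "(nat \<Rightarrow> real \<Rightarrow> complex) \<Rightarrow> nat \<Rightarrow> real \<Rightarrow> complex" where
  "transform F \<tau> x = (\<Sum>\<sigma>\<le>\<tau>. weight \<tau> \<sigma> x *\<^sub>R F \<sigma> x)"

text \<open>The integrand of the p-th power of the Sobolev norm, for a given family \<open>F\<close>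
  in place of the chosen weak derivatives. All estimates are made pointwise against it and
  integrated only at the end.\<close>

definition energy :: "(nat \<Rightarrow> real \<Rightarrow> complex) \<Rightarrow> real \<Rightarrow> real" where
  "energy F x = (\<Sum>\<sigma>\<le>\<alpha>. cmod (F \<sigma> x) powr p *
     rho q m (p * (\<upsilon> - 2 - 2 * real \<alpha>) + 2 + p * (real \<alpha> - real \<sigma>)) x)"

lemma energy_nonneg: "energy F x \<ge> 0"
  unfolding energy_def rho_def by (intro sum_nonneg) auto

text \<open>The product rule produces two terms for each \<sigma>; collecting them by the order of
  the derivative reproduces the recursion \<open>weight_Suc\<close>.\<close>

lemma has_ac_deriv_transform:
  assumes "\<And>\<sigma>. \<sigma> \<le> \<tau> \<Longrightarrow> has_ac_deriv (F \<sigma>) (F (Suc \<sigma>))"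
  shows "has_ac_deriv (transform F \<tau>) (\<lambda>x. (1 / jac x) *\<^sub>R transform F (Suc \<tau>) x)"
proof -
  have "has_ac_deriv (\<lambda>x. \<Sum>\<sigma>\<le>\<tau>. weight \<tau> \<sigma> x *\<^sub>R F \<sigma> x)
      (\<lambda>x. \<Sum>\<sigma>\<le>\<tau>. weight \<tau> \<sigma> x *\<^sub>R F (Suc \<sigma>) x + weight_deriv \<tau> \<sigma> x *\<^sub>R F \<sigma> x)"
    by (intro has_ac_deriv_sum has_ac_deriv_scaleR assms has_ac_deriv_weight) auto
  moreover have "(\<Sum>\<sigma>\<le>\<tau>. weight \<tau> \<sigma> x *\<^sub>R F (Suc \<sigma>) x + weight_deriv \<tau> \<sigma> x *\<^sub>R F \<sigma> x) =
      (1 / jac x) *\<^sub>R transform F (Suc \<tau>) x" for x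
  proof -
    have "transform F (Suc \<tau>) x = jac x *\<^sub>R (\<Sum>\<sigma>\<le>Suc \<tau>. weight_deriv \<tau> \<sigma> x *\<^sub>R F \<sigma> x +
        (case \<sigma> of 0 \<Rightarrow> 0 | Suc \<mu> \<Rightarrow> weight \<tau> \<mu> x) *\<^sub>R F \<sigma> x)"
      unfolding transform_def weight_Suc by (simp only: scaleR_sum_right scaleR_scaleR[symmetric] scaleR_add_left)
    also have "(\<Sum>\<sigma>\<le>Suc \<tau>. weight_deriv \<tau> \<sigma> x *\<^sub>R F \<sigma> x + (case \<sigma> of 0 \<Rightarrow> 0 | Suc \<mu> \<Rightarrow> weight \<tau> \<mu> x) *\<^sub>R F \<sigma> x)
        = (\<Sum>\<sigma>\<le>\<tau>. weight_deriv \<tau> \<sigma> x *\<^sub>R F \<sigma> x) + (\<Sum>\<sigma>\<le>\<tau>. weight \<tau> \<sigma> x *\<^sub>R F (Suc \<sigma>) x)"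
      \<comment> \<open>The first sum loses its last term because
        \<open>weight_deriv \<tau> (Suc \<tau>)\<close> vanishes; the second loses its zeroth term
        and is shifted by one.\<close>
      unfolding sum.distrib by (subst (2) sum.atMost_Suc_shift) (simp add: weight_deriv_eq_0)
    finally show ?thesis using jac_pos[of x] by (simp add: sum.distrib add.commute)
  qed
  ultimately show ?thesis by (simp add: transform_def[abs_def])
qed

lemma transform_powr_le:
  assumes "\<tau> \<le> \<alpha>"
  obtains C where "C > 0"
    "\<And>F x. cmod (transform F \<tau> x) powr p \<le> C * (1 + \<bar>x\<bar>) powr (2 - p * (real \<alpha> - real \<tau>)) * energy F x"
proof -
  let ?\<kappa> = "\<lambda>\<sigma>. p * (\<upsilon> - 2 - 2 * real \<alpha>) + 2 + p * (real \<alpha> - real \<sigma>)"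
  let ?e = "2 - p * (real \<alpha> - real \<tau>)"
  have "\<exists>K>0. \<forall>x. \<bar>weight \<tau> \<sigma> x\<bar> powr p \<le> K * (1 + \<bar>x\<bar>) powr ?e * rho q m (?\<kappa> \<sigma>) x" for \<sigma>
  proof -
    obtain C where C: "C > 0" "\<And>x. \<bar>weight \<tau> \<sigma> x\<bar> \<le> C * (1 + \<bar>x\<bar>) powr (2 - \<upsilon> + real \<tau> + real \<sigma>)"
      using weight_le[of \<tau> \<sigma>] by blast
          obtain A where A: "A > 0" "\<And>x. (1 + \<bar>x\<bar>) powr (- ?\<kappa> \<sigma>) \<le> A * rho q m (?\<kappa> \<sigma>) x"
      using rho_ge[of "?\<kappa> \<sigma>"] by blast
    have "\<bar>weight \<tau> \<sigma> x\<bar> powr p \<le> (C powr p * A) * (1 + \<bar>x\<bar>) powr ?e * rho q m (?\<kappa> \<sigma>) x" for x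
    proof -
      have "\<bar>weight \<tau> \<sigma> x\<bar> powr p \<le> (C * (1 + \<bar>x\<bar>) powr (2 - \<upsilon> + real \<tau> + real \<sigma>)) powr p"
        using p by (intro powr_mono2 C(2)) auto
      also have "\<dots> = C powr p * ((1 + \<bar>x\<bar>) powr ((2 - \<upsilon> + real \<tau> + real \<sigma>) * p))"
        using C(1) by (simp add: powr_mult powr_powr)
      \<comment> \<open>The balance of exponents that determines the weight of the space: after
        removing the weight of the \<sigma>-th summand, what remains does not depend on
        \<sigma>.\<close>
      also have "(2 - \<upsilon> + real \<tau> + real \<sigma>) * p = ?e + - ?\<kappa> \<sigma>"
        by (simp add: algebra_simps)
      also have "C powr p * (1 + \<bar>x\<bar>) powr (?e + - ?\<kappa> \<sigma>) = C powr p * (1 + \<bar>x\<bar>) powr ?e * (1 + \<bar>x\<bar>) powr (- ?\<kappa> \<sigma>)"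
        by (simp only: powr_add mult.assoc)
      also have "\<dots> \<le> C powr p * (1 + \<bar>x\<bar>) powr ?e * (A * rho q m (?\<kappa> \<sigma>) x)"
        by (intro mult_left_mono A(2)) auto
      finally show ?thesis by (simp only: mult_ac)
    qed
    moreover have "C powr p * A > 0" using C A by simp
    ultimately show ?thesis by blast
  qed
  then obtain K where K: "\<And>\<sigma>. K \<sigma> > 0"
    "\<And>\<sigma> x. \<bar>weight \<tau> \<sigma> x\<bar> powr p \<le> K \<sigma> * (1 + \<bar>x\<bar>) powr ?e * rho q m (?\<kappa> \<sigma>) x"
    by metis
  define L where "L = real (card {..\<tau>}) powr p * (\<Sum>\<sigma>\<le>\<tau>. K \<sigma>)"
  have "cmod (transform F \<tau> x) powr p \<le> L * (1 + \<bar>x\<bar>) powr ?e * energy F x" for F x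
  proof -
    let ?y = "(1 + \<bar>x\<bar>) powr ?e"
    have "cmod (transform F \<tau> x) \<le> (\<Sum>\<sigma>\<le>\<tau>. \<bar>weight \<tau> \<sigma> x\<bar> * cmod (F \<sigma> x))"
      unfolding transform_def by (rule order_trans[OF norm_sum]) simp
    then have "cmod (transform F \<tau> x) powr p \<le> (\<Sum>\<sigma>\<le>\<tau>. \<bar>weight \<tau> \<sigma> x\<bar> * cmod (F \<sigma> x)) powr p"
      using p by (intro powr_mono2) auto
    also have "\<dots> \<le> real (card {..\<tau>}) powr p * (\<Sum>\<sigma>\<le>\<tau>. (\<bar>weight \<tau> \<sigma> x\<bar> * cmod (F \<sigma> x)) powr p)"
      using p by (intro sum_powr_le) auto
    also have "\<dots> \<le> real (card {..\<tau>}) powr p * (\<Sum>\<sigma>\<le>\<tau>. K \<sigma> * (?y * energy F x))"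
    proof (intro mult_left_mono sum_mono)
      fix \<sigma> assume \<sigma>: "\<sigma> \<in> {..\<tau>}"
      have "(\<bar>weight \<tau> \<sigma> x\<bar> * cmod (F \<sigma> x)) powr p \<le> (K \<sigma> * ?y * rho q m (?\<kappa> \<sigma>) x) * cmod (F \<sigma> x) powr p"
        unfolding powr_mult by (intro mult_right_mono K) auto
      also have "\<dots> = K \<sigma> * (?y * (cmod (F \<sigma> x) powr p * rho q m (?\<kappa> \<sigma>) x))"
        by (simp only: mult_ac)
      also have "cmod (F \<sigma> x) powr p * rho q m (?\<kappa> \<sigma>) x \<le> energy F x"
        unfolding energy_def using \<sigma> assms by (intro member_le_sum) (auto simp: rho_def)
      finally show "(\<bar>weight \<tau> \<sigma> x\<bar> * cmod (F \<sigma> x)) powr p \<le> K \<sigma> * (?y * energy F x)"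
        using K(1)[of \<sigma>] by (simp add: mult_left_mono)
    qed auto
    finally show ?thesis by (simp add: L_def sum_distrib_right[symmetric] mult.assoc)
  qed
  moreover have "L > 0" unfolding L_def using K(1) by (intro mult_pos_pos sum_pos) auto
  ultimately show ?thesis using that by blast
qed

text \<open>The growth left by \<open>transform_powr_le\<close> is at most quadratic, and the decay
  of \<open>1 / jac x\<close> compensates it. Integrated, this bounds the L^p norm in
  \<theta>.\<close>

lemma transform_jac_powr_le:
  assumes "\<tau> \<le> \<alpha>"
  obtains C where "C > 0" "\<And>F x. (1 / jac x) * cmod (transform F \<tau> x) powr p \<le> C * energy F x"
proof -
  obtain C where C: "C > 0"
    "\<And>F x. cmod (transform F \<tau> x) powr p \<le> C * (1 + \<bar>x\<bar>) powr (2 - p * (real \<alpha> - real \<tau>)) * energy F x"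
    using transform_powr_le[OF assms] by blast
  obtain D where D: "D > 0" "\<And>x. 1 / jac x \<le> D * (1 + \<bar>x\<bar>) powr (-2)"
    by (rule inverse_jac_le) blast
  have "(1 / jac x) * cmod (transform F \<tau> x) powr p \<le> (D * C) * energy F x" for F x
  proof -
    have "cmod (transform F \<tau> x) powr p \<le> C * (1 + \<bar>x\<bar>) powr 2 * energy F x"
      using assms p C(1) energy_nonneg
      by (intro order_trans[OF C(2)] mult_right_mono mult_left_mono powr_mono) auto
    then have "(1 / jac x) * cmod (transform F \<tau> x) powr p \<le> (D * (1 + \<bar>x\<bar>) powr (-2)) * (C * (1 + \<bar>x\<bar>) powr 2 * energy F x)"
      using D by (intro mult_mono) auto
    also have "\<dots> = (D * C) * energy F x * ((1 + \<bar>x\<bar>) powr (-2) * (1 + \<bar>x\<bar>) powr 2)"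
      by (simp only: mult_ac)
    also have "(1 + \<bar>x\<bar>) powr (-2) * (1 + \<bar>x\<bar>) powr 2 = 1"
      by (simp only: powr_add[symmetric]) simp
    finally show ?thesis by simp
  qed
  then show ?thesis using that C(1) D(1) by (metis mult_pos_pos)
qed

end

section \<open>The quadrature error\<close>

lemma absolutely_integrable_all_measurable:
  fixes v :: "real \<Rightarrow> 'a::euclidean_space"
  assumes "\<And>a b. v absolutely_integrable_on {a..b}"
  shows "v \<in> borel_measurable lebesgue"
proof (rule borel_measurable_LIMSEQ_metric)
  show "(\<lambda>x. indicator {- real n..real n} x *\<^sub>R v x) \<in> borel_measurable lebesgue" for n
    using assms[of "- real n" "real n"] unfolding set_integrable_def by (rule borel_measurable_integrable)
  fix x :: real
  have "\<forall>\<^sub>F n in sequentially. v x = indicator {- real n..real n} x *\<^sub>R v x"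
    using eventually_ge_at_top[of "nat \<lceil>\<bar>x\<bar>\<rceil>"]
  proof eventually_elim
    case (elim n)
    then have "\<bar>x\<bar> \<le> real n" by linarith
    then show ?case by (auto simp: indicator_def abs_le_iff)
  qed
  then show "(\<lambda>n. indicator {- real n..real n} x *\<^sub>R v x) \<longlonglongrightarrow> v x"
    by (rule Lim_transform_eventually[OF tendsto_const])
qed

text \<open>The nodes are the odd multiples of pi/n up to 2 n - 1, so they stay away from the
  singularities of \<open>phi\<close> at 0 and 2 pi.\<close>

lemma node_bounds:
  assumes "j \<in> {1..n}"
  shows "0 < node n j" "node n j < 2 * pi"
proof -
  have n: "real n > 0" and "0 < pi * (2 * real j - 1)" "pi * (2 * real j - 1) < pi * (2 * real n)"
    using assms by (auto intro!: mult_strict_left_mono)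
  moreover have "node n j = pi * (2 * real j - 1) / real n"
    by (simp add: node_def diff_divide_distrib right_diff_distrib)
  ultimately show "0 < node n j" "node n j < 2 * pi"
    by (auto simp: pos_divide_less_eq mult_ac)
qed

context moebius_rule
begin

text \<open>Replaces membership in the Sobolev space: the chosen weak derivatives give way to
  representatives each of which is a genuine primitive of the next, up to the last order.\<close>

definition sobolev_chain :: "(nat \<Rightarrow> real \<Rightarrow> complex) \<Rightarrow> bool" where
  "sobolev_chain F \<longleftrightarrow>
     (\<forall>\<sigma><\<alpha>. has_ac_deriv (F \<sigma>) (F (Suc \<sigma>))) \<and> integrable lebesgue (energy F)"

lemma transform_measurable:
  assumes "sobolev_chain F" "\<tau> \<le> \<alpha>"
  shows "transform F \<tau> \<in> borel_measurable lebesgue"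
proof -
  have "F \<sigma> \<in> borel_measurable lebesgue" if \<sigma>: "\<sigma> \<le> \<alpha>" for \<sigma>
  proof (cases "\<sigma> < \<alpha>")
    case True
    then show ?thesis using assms
      by (intro continuous_imp_lebesgue_measurable has_ac_deriv_continuous[of _ "F (Suc \<sigma>)"]) (auto simp: sobolev_chain_def)
  next
    case False
    then obtain \<mu> where "\<sigma> = Suc \<mu>" "\<mu> < \<alpha>" using \<sigma> alpha by (cases \<sigma>) auto
    then show ?thesis using assms
      by (intro absolutely_integrable_all_measurable has_ac_derivD(1)[of "F \<mu>"]) (auto simp: sobolev_chain_def)
  qed
  moreover have "weight \<tau> \<sigma> \<in> borel_measurable lebesgue" for \<sigma>
    by (intro continuous_imp_lebesgue_measurable continuous_weight)
  ultimately show ?thesis unfolding transform_def[abs_def] using assms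
    by (intro borel_measurable_sum borel_measurable_scaleR) auto
qed

lemma jac_measurable: "(\<lambda>x. 1 / jac x) \<in> borel_measurable lebesgue"
  using integrable_inverse_jac by (rule borel_measurable_integrable)

lemma integrable_transform_powr:
  assumes F: "sobolev_chain F" and \<tau>: "\<tau> \<le> \<alpha>"
  shows "integrable lebesgue (\<lambda>x. (1 / jac x) * cmod (transform F \<tau> x) powr p)"
proof -
  obtain C where C: "C > 0" "\<And>F x. (1 / jac x) * cmod (transform F \<tau> x) powr p \<le> C * energy F x"
    using transform_jac_powr_le[OF \<tau>] by blast
  show ?thesis
  proof (rule Bochner_Integration.integrable_bound)
    show "integrable lebesgue (\<lambda>x. C * energy F x)" using F by (simp add: sobolev_chain_def)
    have "(\<lambda>x. cmod (transform F \<tau> x)) \<in> borel_measurable lebesgue"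
      by (rule measurable_compose[OF transform_measurable[OF F \<tau>] borel_measurable_norm])
    then have "(\<lambda>x. cmod (transform F \<tau> x) powr p) \<in> borel_measurable lebesgue"
      by (rule powr_real_measurable) simp
    with jac_measurable show "(\<lambda>x. (1 / jac x) * cmod (transform F \<tau> x) powr p) \<in> borel_measurable lebesgue"
      by (rule borel_measurable_times)
    show "AE x in lebesgue. norm ((1 / jac x) * cmod (transform F \<tau> x) powr p) \<le> norm (C * energy F x)"
    proof (rule AE_I2)
      fix x
      have "0 \<le> (1 / jac x) * cmod (transform F \<tau> x) powr p" using jac_pos[of x] by simp
      then show "norm ((1 / jac x) * cmod (transform F \<tau> x) powr p) \<le> norm (C * energy F x)"
        using C(2)[of x F] by (simp only: real_norm_def)
    qed
  qed
qed

lemma norm_transform_le: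
  assumes "l > 0"
  shows "norm ((1 / jac x) *\<^sub>R transform F \<tau> x) \<le>
    l * (1 / jac x) + l powr (1 - p) * ((1 / jac x) * cmod (transform F \<tau> x) powr p)"
proof -
  have "cmod (transform F \<tau> x) \<le> l + l powr (1 - p) * cmod (transform F \<tau> x) powr p"
    using assms p by (intro le_add_powr) auto
  then have "(1 / jac x) * cmod (transform F \<tau> x) \<le> (1 / jac x) * (l + l powr (1 - p) * cmod (transform F \<tau> x) powr p)"
    using jac_pos[of x] by (intro mult_left_mono) auto
  then show ?thesis using jac_pos[of x] by (simp add: algebra_simps)
qed

text \<open>The measure d\<theta> = dx / jac is finite, so L^p integrability implies L^1
  integrability; the scaled inequality is used with scale 1.\<close>

lemma integrable_transform:
  assumes F: "sobolev_chain F" and \<tau>: "\<tau> \<le> \<alpha>"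
  shows "integrable lebesgue (\<lambda>x. (1 / jac x) *\<^sub>R transform F \<tau> x)"
proof (rule Bochner_Integration.integrable_bound)
  let ?B = "\<lambda>x. 1 * (1 / jac x) + 1 powr (1 - p) * ((1 / jac x) * cmod (transform F \<tau> x) powr p)"
  show "integrable lebesgue ?B"
    using integrable_inverse_jac integrable_transform_powr[OF F \<tau>]
    by (intro Bochner_Integration.integrable_add integrable_mult_right)
  show "(\<lambda>x. (1 / jac x) *\<^sub>R transform F \<tau> x) \<in> borel_measurable lebesgue"
    by (intro borel_measurable_scaleR jac_measurable transform_measurable[OF F \<tau>])
  show "AE x in lebesgue. norm ((1 / jac x) *\<^sub>R transform F \<tau> x) \<le> norm (?B x)"
    by (rule AE_I2, rule order_trans[OF norm_transform_le[OF zero_less_one]])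
       (simp only: real_norm_def abs_ge_self)
qed

text \<open>A scaled Young inequality in place of Hoelder's; optimising over \<open>l\<close> gives the \<open>L\<^sup>p\<close> norm.\<close>

lemma LINT_norm_transform_le:
  obtains C where "C > 0" "\<And>F l. sobolev_chain F \<Longrightarrow> l > 0 \<Longrightarrow>
    (LINT x|lebesgue. norm ((1 / jac x) *\<^sub>R transform F \<alpha> x))
      \<le> 2 * pi * l + l powr (1 - p) * (C * integral\<^sup>L lebesgue (energy F))"
proof -
  obtain C where C: "C > 0" "\<And>F x. (1 / jac x) * cmod (transform F \<alpha> x) powr p \<le> C * energy F x"
    using transform_jac_powr_le[OF order_refl] by blast
  have "(LINT x|lebesgue. norm ((1 / jac x) *\<^sub>R transform F \<alpha> x))
      \<le> 2 * pi * l + l powr (1 - p) * (C * integral\<^sup>L lebesgue (energy F))"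
    if F: "sobolev_chain F" and l: "l > 0" for F l
  proof -
    have E: "integrable lebesgue (energy F)" using F by (simp add: sobolev_chain_def)
    have "(LINT x|lebesgue. norm ((1 / jac x) *\<^sub>R transform F \<alpha> x))
        \<le> (LINT x|lebesgue. l * (1 / jac x) + l powr (1 - p) * (C * energy F x))"
    proof (rule integral_mono)
      show "integrable lebesgue (\<lambda>x. norm ((1 / jac x) *\<^sub>R transform F \<alpha> x))"
        by (intro integrable_norm integrable_transform F order_refl)
      show "integrable lebesgue (\<lambda>x. l * (1 / jac x) + l powr (1 - p) * (C * energy F x))"
        using E integrable_inverse_jac by (intro Bochner_Integration.integrable_add integrable_mult_right)
      show "norm ((1 / jac x) *\<^sub>R transform F \<alpha> x) \<le> l * (1 / jac x) + l powr (1 - p) * (C * energy F x)" for x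
        using l by (intro order_trans[OF norm_transform_le[OF l]] add_left_mono mult_left_mono C(2)) auto
    qed
    also have "\<dots> = (LINT x|lebesgue. l * (1 / jac x)) + (LINT x|lebesgue. l powr (1 - p) * (C * energy F x))"
      using E integrable_inverse_jac by (intro Bochner_Integration.integral_add integrable_mult_right)
    also have "(LINT x|lebesgue. l * (1 / jac x)) = l * (2 * pi)"
      by (subst integral_mult_right_zero) (simp only: LINT_inverse_jac)
    also have "(LINT x|lebesgue. l powr (1 - p) * (C * energy F x)) = l powr (1 - p) * (C * integral\<^sup>L lebesgue (energy F))"
      by (simp only: integral_mult_right_zero)
    finally show ?thesis by (simp only: mult_ac)
  qed
  with C(1) show ?thesis using that by blast
qed

lemma has_ac_deriv_transform_chain:
  assumes "sobolev_chain F" "\<tau> < \<alpha>"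
  shows "has_ac_deriv (transform F \<tau>) (\<lambda>x. (1 / jac x) *\<^sub>R transform F (Suc \<tau>) x)"
  using assms by (intro has_ac_deriv_transform) (auto simp: sobolev_chain_def)

text \<open>The limits at infinity exist since the derivative is integrable; the stronger weight on lower
  order derivatives forces them to vanish.\<close>

lemma transform_vanishes:
  assumes F: "sobolev_chain F" and \<tau>: "\<tau> < \<alpha>"
  shows "(transform F \<tau> \<longlongrightarrow> 0) at_top" "(transform F \<tau> \<longlongrightarrow> 0) at_bot"
proof -
  have ac: "has_ac_deriv (transform F \<tau>) (\<lambda>x. (1 / jac x) *\<^sub>R transform F (Suc \<tau>) x)"
    using F \<tau> by (rule has_ac_deriv_transform_chain)
  have int: "integrable lebesgue (\<lambda>x. (1 / jac x) *\<^sub>R transform F (Suc \<tau>) x)"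
    using F \<tau> by (intro integrable_transform) auto
  obtain C where C: "C > 0"
    "\<And>F x. cmod (transform F \<tau> x) powr p \<le> C * (1 + \<bar>x\<bar>) powr (2 - p * (real \<alpha> - real \<tau>)) * energy F x"
    using transform_powr_le[OF less_imp_le[OF \<tau>]] by blast
  \<comment> \<open>From p > 1 and \<alpha> - \<tau> >= 1. This lowers the growth to a single factor
    1 + |x|, the borderline case that \<open>limit_zero_at_top\<close> and
    \<open>limit_zero_at_bot\<close> can treat.\<close>
  have "1 * 1 \<le> p * (real \<alpha> - real \<tau>)" using p \<tau> by (intro mult_mono) auto
  then have "(1 + \<bar>x\<bar>) powr (2 - p * (real \<alpha> - real \<tau>)) \<le> (1 + \<bar>x\<bar>) powr 1" for x
    by (intro powr_mono) auto
  then have "C * (1 + \<bar>x\<bar>) powr (2 - p * (real \<alpha> - real \<tau>)) * energy F x \<le> C * (1 + \<bar>x\<bar>) * energy F x" for x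
    using C(1) energy_nonneg by (intro mult_right_mono mult_left_mono) auto
  then have le: "cmod (transform F \<tau> x) powr p \<le> C * (1 + \<bar>x\<bar>) * energy F x" for x
    using C(2)[of F x] order_trans by blast
  have E: "integrable lebesgue (energy F)" using F by (simp add: sobolev_chain_def)
  have p0: "p > 0" using p by simp
  note t = has_ac_deriv_tendsto_at_top[OF ac int, of 0] has_ac_deriv_tendsto_at_bot[OF ac int, of 0]
  show "(transform F \<tau> \<longlongrightarrow> 0) at_top"
    using t(1) limit_zero_at_top[OF t(1) E energy_nonneg le p0 C(1)] by simp
  show "(transform F \<tau> \<longlongrightarrow> 0) at_bot"
    using t(2) limit_zero_at_bot[OF t(2) E energy_nonneg le p0 C(1)] by simp
qed

section \<open>Kernels adapted to the nodes and integration by parts\<close>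

lemma angle_preimage_finite:
  assumes "h > 0"
  shows "finite {x. angle x / h + 1 / 2 \<in> \<int>}"
proof -
  let ?S = "{x. angle x / h + 1 / 2 \<in> \<int>}"
  \<comment> \<open>The points of \<open>?S\<close> have angles (k - 1/2) h with integer k.
    Boundedness of \<open>angle\<close> leaves finitely many k, and injectivity gives at most one
    point for each.\<close>
  have "inj_on angle ?S"
    using angle_le_iff by (intro inj_onI) (metis order_antisym order_refl)
  moreover have "angle ` ?S \<subseteq> (\<lambda>k. (of_int k - 1 / 2) * h) ` {0..\<lceil>2 * pi / h + 1 / 2\<rceil>}"
  proof clarify
    fix x assume "angle x / h + 1 / 2 \<in> \<int>"
    then obtain k where k: "angle x / h + 1 / 2 = of_int k" by (auto elim: Ints_cases)
    have "0 < angle x / h" "angle x / h < 2 * pi / h"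
      using angle_bounds[of x] assms by (auto simp: divide_strict_right_mono)
    then have "k \<in> {0..\<lceil>2 * pi / h + 1 / 2\<rceil>}" using k by (simp, linarith)
    moreover have "angle x = (of_int k - 1 / 2) * h" using k assms by (simp add: field_simps)
    ultimately show "angle x \<in> (\<lambda>k. (of_int k - 1 / 2) * h) ` {0..\<lceil>2 * pi / h + 1 / 2\<rceil>}" by blast
  qed
  ultimately show ?thesis using finite_imageD finite_subset by blast
qed

text \<open>The shift by 1/2 places the integers at the nodes. The factor \<open>h\<close>
  compensates the 1/h of the chain rule, so each integration by parts gains one power of
  \<open>h\<close>.\<close>

lemma has_ac_deriv_kernel:
  fixes b :: "real \<Rightarrow> real"
  assumes h: "h > 0" and b: "continuous_on UNIV b"
    and D: "\<And>t. t \<notin> \<int> \<Longrightarrow> (b has_real_derivative b' t) (at t)"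
    and b': "b' \<in> borel_measurable borel" "\<And>t. \<bar>b' t\<bar> \<le> M"
  shows "has_ac_deriv (\<lambda>x. h * b (angle x / h + 1 / 2)) (\<lambda>x. (1 / jac x) * b' (angle x / h + 1 / 2))"
proof (rule has_ac_deriv_FTC[OF angle_preimage_finite[OF h]])
  show "continuous_on UNIV (\<lambda>x. h * b (angle x / h + 1 / 2))"
    using h by (intro continuous_intros continuous_on_compose2[OF b] continuous_angle) auto
  show "((\<lambda>x. h * b (angle x / h + 1 / 2)) has_vector_derivative (1 / jac x) * b' (angle x / h + 1 / 2)) (at x)"
    if "x \<notin> {x. angle x / h + 1 / 2 \<in> \<int>}" for x
  proof -
    have "((\<lambda>x. angle x / h + 1 / 2) has_real_derivative (1 / jac x) / h) (at x)"
      using DERIV_add[OF DERIV_cdivide[OF DERIV_angle, of h x] DERIV_const[of "1 / 2"]] by simp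
    from DERIV_chain2[OF D this] that
    have "((\<lambda>x. b (angle x / h + 1 / 2)) has_real_derivative b' (angle x / h + 1 / 2) * ((1 / jac x) / h)) (at x)"
      by blast
    from DERIV_cmult[OF this, of h] h show ?thesis
      by (simp add: has_real_derivative_iff_has_vector_derivative mult_ac)
  qed
  show "(\<lambda>x. (1 / jac x) * b' (angle x / h + 1 / 2)) absolutely_integrable_on {a..c}" for a c
  proof -
    have "(\<lambda>x. angle x / h + 1 / 2) \<in> borel_measurable borel"
      by (intro borel_measurable_continuous_onI continuous_intros continuous_angle) (use h in auto)
    from measurable_compose[OF this b'(1)]
    have "(\<lambda>x. b' (angle x / h + 1 / 2)) \<in> borel_measurable lebesgue"
      by (rule borel_imp_lebesgue_measurable)
    then have "integrable lebesgue (\<lambda>x. b' (angle x / h + 1 / 2) *\<^sub>R (1 / jac x))"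
      by (intro integrable_bounded_scaleR[OF integrable_inverse_jac]) (use b'(2) in auto)
    then have "integrable lebesgue (\<lambda>x. (1 / jac x) * b' (angle x / h + 1 / 2))"
      by (simp only: real_scaleR_def mult.commute)
    then show ?thesis
      unfolding set_integrable_def by (intro integrable_mult_indicator) auto
  qed
qed

text \<open>The Peano kernel of the midpoint rule: the left side is the combination of identity,
  jumps at the nodes and constant that produces the error. With k the ceiling of angle/h + 1/2, the
  nodes at or to the right of \<open>x\<close> have indices k to n, and h n = 2 pi removes
  n.\<close>

lemma node_count:
  assumes n: "n \<ge> 1" and h: "h = 2 * pi / real n"
  shows "angle x + h * (\<Sum>j=1..n. indicator {..phi \<gamma> (node n j)} x) - 2 * pi = h * sawtooth (angle x / h + 1 / 2)"
proof -
  have h0: "h > 0" using n by (simp add: h)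
  have hn: "h * real n = 2 * pi" using n by (simp add: h)
  define k where "k = \<lceil>angle x / h + 1 / 2\<rceil>"
  have "0 < angle x / h" "angle x / h < real n"
    using angle_bounds[of x] h0 hn by (auto simp: pos_divide_less_eq mult.commute)
  \<comment> \<open>The value n + 1 occurs to the right of the last node; the then empty index range
    still has n + 1 - k elements.\<close>
  then have k: "1 \<le> k" "k \<le> int n + 1" unfolding k_def by linarith+
  have node: "node n j = h * real j - h / 2" for j by (simp add: node_def h)
  have "indicator {..phi \<gamma> (node n j)} x = (if j \<in> {nat k..n} then 1 else (0::real))" if j: "j \<in> {1..n}" for j
  proof -
    have "x \<le> phi \<gamma> (node n j) \<longleftrightarrow> angle x \<le> node n j"
      using angle_le_iff[of x "phi \<gamma> (node n j)"] angle_phi(1)[OF node_bounds[OF j]] by simp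
    also have "\<dots> \<longleftrightarrow> angle x / h + 1 / 2 \<le> of_int (int j)" using h0 by (simp add: node field_simps)
    also have "\<dots> \<longleftrightarrow> k \<le> int j" unfolding k_def by (rule ceiling_le_iff[symmetric])
    also have "\<dots> \<longleftrightarrow> j \<in> {nat k..n}" using j by (simp add: nat_le_iff)
    finally show ?thesis by (simp add: indicator_def)
  qed
  then have "(\<Sum>j=1..n. indicator {..phi \<gamma> (node n j)} x) = (\<Sum>j=1..n. if j \<in> {nat k..n} then 1 else (0::real))"
    by (intro sum.cong) auto
  also have "\<dots> = real (card ({1..n} \<inter> {nat k..n}))"
    by (simp only: real_of_card sum.inter_restrict[OF finite_atLeastAtMost])
  also have "{1..n} \<inter> {nat k..n} = {nat k..n}" using k by auto
  also have "real (card {nat k..n}) = real n + 1 - of_int k" using k by (simp add: of_nat_diff)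
  finally have "angle x + h * (\<Sum>j=1..n. indicator {..phi \<gamma> (node n j)} x) - 2 * pi =
      angle x + h * (real n + 1 - of_int k) - h * real n"
    using hn by (simp only:)
  also have "\<dots> = angle x + h * (1 - of_int k)" by (simp add: algebra_simps)
  also have "\<dots> = h * sawtooth (angle x / h + 1 / 2)"
    unfolding sawtooth_def k_def[symmetric] using h0 by (simp add: field_simps)
  finally show ?thesis .
qed

text \<open>By \<open>node_count\<close> the kernel splits into three parts. The angle integrates by
  parts to minus the integral, each half-line indicator gives the value at a node, and the constant
  2 pi contributes 0.\<close>

lemma quadrature_error_eq:
  assumes F: "sobolev_chain F" and n: "n \<ge> 1" and h: "h = 2 * pi / real n"
  shows "(LINT x|lebesgue. (h * sawtooth (angle x / h + 1 / 2)) *\<^sub>R (1 / jac x) *\<^sub>R transform F 1 x) =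
     of_real h * (\<Sum>j=1..n. transform F 0 (phi \<gamma> (node n j))) - (LINT x|lebesgue. (1 / jac x) *\<^sub>R transform F 0 x)"
proof -
  define v where "v x = (1 / jac x) *\<^sub>R transform F 1 x" for x
  have al: "0 < \<alpha>" "1 \<le> \<alpha>" using alpha by auto
  have ac: "has_ac_deriv (transform F 0) v"
    using has_ac_deriv_transform_chain[OF F al(1)] by (simp add: v_def[abs_def])
  have v: "integrable lebesgue v"
    unfolding v_def[abs_def] using F al by (intro integrable_transform)
  note vanish = transform_vanishes[OF F al(1)]
  note half = vanishing_ac_deriv[OF ac v vanish]
  have int0: "integrable lebesgue (\<lambda>x. (1 / jac x) *\<^sub>R transform F 0 x)"
    using F by (intro integrable_transform) auto
  have angle: "\<bar>angle x\<bar> \<le> 2 * pi" for x using angle_bounds[of x] by simp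
  have intA: "integrable lebesgue (\<lambda>x. angle x *\<^sub>R v x)"
    by (rule integrable_bounded_scaleR[OF v _ angle])
       (intro continuous_imp_lebesgue_measurable continuous_angle)
  \<comment> \<open>The integrand is the derivative of angle times \<open>transform F 0\<close>, a
    product that vanishes at both ends because the angle is bounded.\<close>
  have "(LINT x|lebesgue. angle x *\<^sub>R v x + (1 / jac x) *\<^sub>R transform F 0 x) = 0"
    by (rule vanishing_ac_deriv(2)[OF has_ac_deriv_scaleR[OF ac has_ac_deriv_angle]])
       (intro Bochner_Integration.integrable_add intA int0 tendsto_bounded_scaleR_zero[OF _ angle] vanish)+
  then have A: "(LINT x|lebesgue. angle x *\<^sub>R v x) = - (LINT x|lebesgue. (1 / jac x) *\<^sub>R transform F 0 x)"
    using intA int0 by (simp add: eq_neg_iff_add_eq_0)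
  have intI: "integrable lebesgue (\<lambda>x. indicator {..c} x *\<^sub>R v x)" for c
    using v by (intro integrable_mult_indicator) auto
  have "(LINT x|lebesgue. (h * sawtooth (angle x / h + 1 / 2)) *\<^sub>R v x) =
     (LINT x|lebesgue. angle x *\<^sub>R v x + h *\<^sub>R (\<Sum>j=1..n. indicator {..phi \<gamma> (node n j)} x *\<^sub>R v x) - (2 * pi) *\<^sub>R v x)"
    unfolding node_count[OF n h, symmetric]
    by (simp only: scaleR_diff_left scaleR_add_left scaleR_sum_left scaleR_scaleR[symmetric])
  also have "\<dots> = (LINT x|lebesgue. angle x *\<^sub>R v x) +
     h *\<^sub>R (\<Sum>j=1..n. LINT x|lebesgue. indicator {..phi \<gamma> (node n j)} x *\<^sub>R v x) - (2 * pi) *\<^sub>R integral\<^sup>L lebesgue v"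
  proof -
    have intS: "integrable lebesgue (\<lambda>x. h *\<^sub>R (\<Sum>j=1..n. indicator {..phi \<gamma> (node n j)} x *\<^sub>R v x))"
      by (intro integrable_scaleR_right Bochner_Integration.integrable_sum intI)
    have intV: "integrable lebesgue (\<lambda>x. (2 * pi) *\<^sub>R v x)"
      using v by (rule integrable_scaleR_right)
    have "(LINT x|lebesgue. h *\<^sub>R (\<Sum>j=1..n. indicator {..phi \<gamma> (node n j)} x *\<^sub>R v x)) =
        h *\<^sub>R (\<Sum>j=1..n. LINT x|lebesgue. indicator {..phi \<gamma> (node n j)} x *\<^sub>R v x)"
      by (simp only: integral_scaleR_right Bochner_Integration.integral_sum[OF intI])
    then show ?thesis
      by (simp only: Bochner_Integration.integral_diff[OF Bochner_Integration.integrable_add[OF intA intS] intV]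
        Bochner_Integration.integral_add[OF intA intS] integral_scaleR_right)
  qed
  finally show ?thesis unfolding half A by (simp add: v_def scaleR_conv_of_real)
qed

text \<open>Stated for norms because every integration by parts changes the sign. Boundary terms
  vanish since the kernels are bounded and the transforms of order below \<alpha> tend to 0.\<close>

lemma iterated_parts:
  fixes b :: "nat \<Rightarrow> real \<Rightarrow> real"
  assumes F: "sobolev_chain F" and h: "h > 0"
    and b0: "b 0 = sawtooth"
    and b_cont: "\<And>k. continuous_on UNIV (b (Suc k))"
    and b_D: "\<And>k t. k \<ge> 1 \<or> t \<notin> \<int> \<Longrightarrow> (b (Suc k) has_real_derivative b k t) (at t)"
    and b_bound: "\<And>k. \<exists>M. \<forall>t. \<bar>b k t\<bar> \<le> M"
    and k: "k < \<alpha>"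
  shows "norm (LINT x|lebesgue. (h * sawtooth (angle x / h + 1 / 2)) *\<^sub>R (1 / jac x) *\<^sub>R transform F 1 x) =
     norm (LINT x|lebesgue. (h ^ Suc k * b k (angle x / h + 1 / 2)) *\<^sub>R (1 / jac x) *\<^sub>R transform F (Suc k) x)"
  using k
proof (induction k)
  case 0
  then show ?case by (simp add: b0)
next
  case (Suc k)
  define K where "K i x = h ^ Suc i * b i (angle x / h + 1 / 2)" for i x
  have meas: "b i \<in> borel_measurable borel" for i
    using b0 b_cont by (cases i) (auto intro: borel_measurable_continuous_onI)
  have K_meas: "K i \<in> borel_measurable lebesgue" for i
  proof -
    have "(\<lambda>x. angle x / h + 1 / 2) \<in> borel_measurable borel"
      by (intro borel_measurable_continuous_onI continuous_intros continuous_angle) (use h in auto)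
    from measurable_compose[OF this meas[of i]] show ?thesis
      unfolding K_def[abs_def] by (intro borel_imp_lebesgue_measurable borel_measurable_times borel_measurable_const)
  qed
  have K_bound: "\<exists>M. \<forall>x. \<bar>K i x\<bar> \<le> M" for i
  proof -
    obtain M where "\<And>t. \<bar>b i t\<bar> \<le> M" using b_bound by blast
    then have "\<bar>K i x\<bar> \<le> h ^ Suc i * M" for x
      using h by (auto simp: K_def abs_mult intro!: mult_left_mono simp del: power_Suc)
    then show ?thesis by blast
  qed
  obtain M where M: "\<And>t. \<bar>b k t\<bar> \<le> M" using b_bound by blast
  have "has_ac_deriv (\<lambda>x. h * b (Suc k) (angle x / h + 1 / 2)) (\<lambda>x. (1 / jac x) * b k (angle x / h + 1 / 2))"
    using h b_cont b_D meas M by (intro has_ac_deriv_kernel) auto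
  \<comment> \<open>The constant power of \<open>h\<close> is attached by the product rule with a
    constant factor of derivative 0.\<close>
  from has_ac_deriv_scaleR[OF this has_ac_deriv_C1[of "\<lambda>_. h ^ Suc k" "\<lambda>_. 0"]]
  have acK: "has_ac_deriv (K (Suc k)) (\<lambda>x. (1 / jac x) * K k x)"
    by (simp add: K_def[abs_def] mult_ac)
  let ?v = "\<lambda>x. (1 / jac x) *\<^sub>R transform F (Suc (Suc k)) x"
  have ac: "has_ac_deriv (transform F (Suc k)) ?v"
    using F Suc.prems by (rule has_ac_deriv_transform_chain)
  obtain M1 where M1: "\<And>x. \<bar>K (Suc k) x\<bar> \<le> M1" using K_bound by blast
  obtain M0 where M0: "\<And>x. \<bar>K k x\<bar> \<le> M0" using K_bound by blast
  have int1: "integrable lebesgue (\<lambda>x. K (Suc k) x *\<^sub>R ?v x)"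
    using F Suc.prems by (intro integrable_bounded_scaleR[OF _ K_meas M1] integrable_transform) auto
  have int0: "integrable lebesgue (\<lambda>x. K k x *\<^sub>R (1 / jac x) *\<^sub>R transform F (Suc k) x)"
    using F Suc.prems by (intro integrable_bounded_scaleR[OF _ K_meas M0] integrable_transform) auto
  have eq: "((1 / jac x) * K k x) *\<^sub>R transform F (Suc k) x = K k x *\<^sub>R (1 / jac x) *\<^sub>R transform F (Suc k) x" for x
    by (simp add: mult.commute)
  have "(LINT x|lebesgue. K (Suc k) x *\<^sub>R ?v x + ((1 / jac x) * K k x) *\<^sub>R transform F (Suc k) x) = 0"
  proof (rule vanishing_ac_deriv(2)[OF has_ac_deriv_scaleR[OF ac acK]])
    show "integrable lebesgue (\<lambda>x. K (Suc k) x *\<^sub>R ?v x + ((1 / jac x) * K k x) *\<^sub>R transform F (Suc k) x)"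
      unfolding eq by (intro Bochner_Integration.integrable_add int1 int0)
  qed (intro tendsto_bounded_scaleR_zero[OF _ M1] transform_vanishes[OF F Suc.prems])+
  then have "(LINT x|lebesgue. K (Suc k) x *\<^sub>R ?v x) + (LINT x|lebesgue. K k x *\<^sub>R (1 / jac x) *\<^sub>R transform F (Suc k) x) = 0"
    unfolding eq using Bochner_Integration.integral_add[OF int1 int0] by simp
  then have "norm (LINT x|lebesgue. K k x *\<^sub>R (1 / jac x) *\<^sub>R transform F (Suc k) x) = norm (LINT x|lebesgue. K (Suc k) x *\<^sub>R ?v x)"
    by (simp add: add_eq_0_iff)
  with Suc show ?case by (simp add: K_def)
qed

text \<open>Here \<open>l\<close> is a positive upper bound for the Sobolev norm. Taken as the scale
  in \<open>LINT_norm_transform_le\<close>, it makes both terms of that bound multiples of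
  \<open>l\<close>.\<close>

lemma quadrature_error_le:
  obtains C where "C > 0" "\<And>F n l. sobolev_chain F \<Longrightarrow> n \<ge> 1 \<Longrightarrow> l > 0 \<Longrightarrow>
      integral\<^sup>L lebesgue (energy F) \<le> l powr p \<Longrightarrow>
      norm ((LINT x|lebesgue. (1 / jac x) *\<^sub>R transform F 0 x) -
        of_real (2 * pi / real n) * (\<Sum>j=1..n. transform F 0 (phi \<gamma> (node n j))))
      \<le> C * real n powr (- real \<alpha>) * l"
proof -
  obtain b :: "nat \<Rightarrow> real \<Rightarrow> real" where b: "b 0 = sawtooth"
    "\<And>k. continuous_on UNIV (b (Suc k))"
    "\<And>k t. k \<ge> 1 \<or> t \<notin> \<int> \<Longrightarrow> (b (Suc k) has_real_derivative b k t) (at t)"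
    "\<And>k. \<exists>M. \<forall>t. \<bar>b k t\<bar> \<le> M"
    using periodic_kernels by metis
  obtain C where C: "C > 0" "\<And>F l. sobolev_chain F \<Longrightarrow> l > 0 \<Longrightarrow>
    (LINT x|lebesgue. norm ((1 / jac x) *\<^sub>R transform F \<alpha> x))
      \<le> 2 * pi * l + l powr (1 - p) * (C * integral\<^sup>L lebesgue (energy F))"
    using LINT_norm_transform_le by blast
  \<comment> \<open>The kernel of index k is paired with the transform of order k + 1, so the full
    order \<alpha> is reached at \<alpha> - 1.\<close>
  define k where "k = \<alpha> - 1"
  have k: "k < \<alpha>" "Suc k = \<alpha>" using alpha by (auto simp: k_def)
  obtain M0 where M0: "\<And>t. \<bar>b k t\<bar> \<le> M0" using b(4) by blast
  define M where "M = 1 + \<bar>M0\<bar>"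
  have M: "M > 0" "\<And>t. \<bar>b k t\<bar> \<le> M" using order_trans[OF M0, of "1 + \<bar>M0\<bar>"] by (auto simp: M_def)
  \<comment> \<open>The power of 2 pi comes from h^\<alpha>, \<open>M\<close> bounds the last
    kernel, and 2 pi + C is the constant of the L^1 bound of the top derivative.\<close>
  define L where "L = (2 * pi) ^ \<alpha> * M * (2 * pi + C)"
  have "norm ((LINT x|lebesgue. (1 / jac x) *\<^sub>R transform F 0 x) -
        of_real (2 * pi / real n) * (\<Sum>j=1..n. transform F 0 (phi \<gamma> (node n j))))
      \<le> L * real n powr (- real \<alpha>) * l"
    if F: "sobolev_chain F" and n: "n \<ge> 1" and l: "l > 0" and E: "integral\<^sup>L lebesgue (energy F) \<le> l powr p" for F n l
  proof -
    define h where "h = 2 * pi / real n"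
    have h: "h > 0" using n by (simp add: h_def)
    let ?v = "\<lambda>x. (1 / jac x) *\<^sub>R transform F \<alpha> x"
    have v: "integrable lebesgue ?v" using F by (intro integrable_transform) auto
    have "norm ((LINT x|lebesgue. (1 / jac x) *\<^sub>R transform F 0 x) -
        of_real h * (\<Sum>j=1..n. transform F 0 (phi \<gamma> (node n j)))) =
      norm (LINT x|lebesgue. (h * sawtooth (angle x / h + 1 / 2)) *\<^sub>R (1 / jac x) *\<^sub>R transform F 1 x)"
      unfolding quadrature_error_eq[OF F n h_def] by (rule norm_minus_commute)
    also have "\<dots> = norm (LINT x|lebesgue. (h ^ \<alpha> * b k (angle x / h + 1 / 2)) *\<^sub>R ?v x)"
      using iterated_parts[OF F h b k(1)] unfolding k(2) .
    also have "\<dots> \<le> (LINT x|lebesgue. h ^ \<alpha> * M * norm (?v x))"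
    proof (rule Bochner_Integration.integral_norm_bound_integral)
      have "(\<lambda>x. angle x / h + 1 / 2) \<in> borel_measurable borel"
        by (intro borel_measurable_continuous_onI continuous_intros continuous_angle) (use h in auto)
      moreover have "b k \<in> borel_measurable borel"
        using b(1,2) by (cases k) (auto intro: borel_measurable_continuous_onI)
      ultimately have "(\<lambda>x. b k (angle x / h + 1 / 2)) \<in> borel_measurable lebesgue"
        by (intro borel_imp_lebesgue_measurable) (rule measurable_compose)
      then have meas: "(\<lambda>x. h ^ \<alpha> * b k (angle x / h + 1 / 2)) \<in> borel_measurable lebesgue"
        by (intro borel_measurable_times borel_measurable_const)
      have bound: "\<bar>h ^ \<alpha> * b k (angle x / h + 1 / 2)\<bar> \<le> h ^ \<alpha> * M" for x
        using h M(2) by (auto simp: abs_mult intro!: mult_left_mono)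
      show "integrable lebesgue (\<lambda>x. (h ^ \<alpha> * b k (angle x / h + 1 / 2)) *\<^sub>R ?v x)"
        by (rule integrable_bounded_scaleR[OF v meas bound])
      show "integrable lebesgue (\<lambda>x. h ^ \<alpha> * M * norm (?v x))"
        using v by (intro integrable_mult_right integrable_norm)
      show "norm ((h ^ \<alpha> * b k (angle x / h + 1 / 2)) *\<^sub>R ?v x) \<le> h ^ \<alpha> * M * norm (?v x)" for x
        unfolding norm_scaleR[of "h ^ \<alpha> * _"] by (intro mult_right_mono bound) simp
    qed
    also have "\<dots> = h ^ \<alpha> * M * (LINT x|lebesgue. norm (?v x))"
      by (rule integral_mult_right_zero)
    also have "\<dots> \<le> h ^ \<alpha> * M * ((2 * pi + C) * l)"
    proof (rule mult_left_mono)
      have "(LINT x|lebesgue. norm (?v x)) \<le> 2 * pi * l + l powr (1 - p) * (C * integral\<^sup>L lebesgue (energy F))"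
        by (rule C(2)[OF F l])
      also have "\<dots> \<le> 2 * pi * l + l powr (1 - p) * (C * l powr p)"
        using C(1) E by (intro add_left_mono mult_left_mono) auto
      also have "l powr (1 - p) * (C * l powr p) = C * (l powr (1 - p) * l powr p)"
        by (simp only: mult_ac)
      also have "l powr (1 - p) * l powr p = l"
        using l by (simp add: powr_add[symmetric])
      finally show "(LINT x|lebesgue. norm (?v x)) \<le> (2 * pi + C) * l" by (simp add: algebra_simps)
    qed (use h M in simp)
    also have "h ^ \<alpha> = (2 * pi) ^ \<alpha> * real n powr (- real \<alpha>)"
      using n by (simp add: h_def power_divide powr_minus powr_realpow divide_inverse power_mult_distrib power_inverse)
    finally show ?thesis by (simp add: L_def h_def mult_ac)
  qed
  moreover have "L > 0" using C(1) M(1) by (simp add: L_def add_pos_pos)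
  ultimately show ?thesis using that by blast
qed

end

section \<open>From weak derivatives to the error bound\<close>

context moebius_rule
begin

abbreviation sobolev_weight_exponent :: real where
  "sobolev_weight_exponent \<equiv> p * (\<upsilon> - 2 - 2 * real \<alpha>) + 2"

lemma sobolev_chain_of_weak_derivs:
  assumes f: "f \<in> var_sobolev q m \<alpha> p sobolev_weight_exponent"
  obtains F where "sobolev_chain F" "AE x in lebesgue. F 0 x = f x"
    "integral\<^sup>L lebesgue (energy F) \<le> var_sobolev_norm q m \<alpha> p sobolev_weight_exponent f powr p"
proof -
  let ?g = "\<lambda>\<sigma>. weak_deriv \<sigma> f"
  let ?r = "\<lambda>\<sigma>. rho q m (sobolev_weight_exponent + p * (real \<alpha> - real \<sigma>))"
  have g: "has_weak_deriv \<sigma> f (?g \<sigma>)" if "\<sigma> \<le> \<alpha>" for \<sigma>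
  proof -
    have "\<exists>g. has_weak_deriv \<sigma> f g" using f that unfolding var_sobolev_def by blast
    then show ?thesis unfolding weak_deriv_def by (rule someI_ex)
  qed
  have g_int: "integrable lebesgue (\<lambda>x. cmod (?g \<sigma> x) powr p * ?r \<sigma> x)" if "\<sigma> \<le> \<alpha>" for \<sigma>
    using f that unfolding var_sobolev_def by auto
  have "\<exists>G. has_ac_deriv G (?g (Suc \<sigma>)) \<and> (AE x in lebesgue. G x = ?g \<sigma> x)" if "\<sigma> < \<alpha>" for \<sigma>
    using has_weak_deriv_ac_representative[OF g g, of \<sigma>] that by (metis Suc_leI less_imp_le)
  then obtain G where G: "\<And>\<sigma>. \<sigma> < \<alpha> \<Longrightarrow> has_ac_deriv (G \<sigma>) (?g (Suc \<sigma>))"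
    "\<And>\<sigma>. \<sigma> < \<alpha> \<Longrightarrow> AE x in lebesgue. G \<sigma> x = ?g \<sigma> x"
    by metis
  \<comment> \<open>The top derivative has no successor to be a primitive of, so it is kept as the
    chosen weak derivative.\<close>
  define F where "F \<sigma> = (if \<sigma> < \<alpha> then G \<sigma> else ?g \<sigma>)" for \<sigma>
  have AE: "AE x in lebesgue. F \<sigma> x = ?g \<sigma> x" for \<sigma>
    using G(2) by (auto simp: F_def)
  have ac: "has_ac_deriv (F \<sigma>) (F (Suc \<sigma>))" if "\<sigma> < \<alpha>" for \<sigma>
  \<comment> \<open>\<open>G \<sigma>\<close> was built as a primitive of the chosen weak derivative
    of the next order; that one is now exchanged for the representative
    \<open>F (Suc \<sigma>)\<close>.\<close>
  proof (rule has_ac_deriv_cong_AE)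
    show "has_ac_deriv (F \<sigma>) (?g (Suc \<sigma>))" using G(1) that by (simp add: F_def)
    show "AE x in lebesgue. ?g (Suc \<sigma>) x = F (Suc \<sigma>) x"
      using AE[of "Suc \<sigma>"] by eventually_elim simp
  qed
  let ?t = "\<lambda>\<sigma> x. cmod (F \<sigma> x) powr p * ?r \<sigma> x"
  have eq: "AE x in lebesgue. cmod (?g \<sigma> x) powr p * ?r \<sigma> x = ?t \<sigma> x" for \<sigma>
    using AE[of \<sigma>] by eventually_elim simp
  have t_int: "integrable lebesgue (?t \<sigma>)"
    and t_eq: "integral\<^sup>L lebesgue (\<lambda>x. cmod (?g \<sigma> x) powr p * ?r \<sigma> x) = integral\<^sup>L lebesgue (?t \<sigma>)"
    if "\<sigma> \<le> \<alpha>" for \<sigma>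
  proof -
    note m1 = borel_measurable_integrable[OF g_int[OF that]]
    note m2 = borel_measurable_AE[OF m1 eq]
    show "integrable lebesgue (?t \<sigma>)"
      using integrable_cong_AE[OF m1 m2 eq] g_int[OF that] by simp
    show "integral\<^sup>L lebesgue (\<lambda>x. cmod (?g \<sigma> x) powr p * ?r \<sigma> x) = integral\<^sup>L lebesgue (?t \<sigma>)"
      by (rule integral_cong_AE[OF m1 m2 eq])
  qed
  have E: "integrable lebesgue (energy F)"
    unfolding energy_def[abs_def] by (intro Bochner_Integration.integrable_sum t_int) simp
  let ?S = "\<Sum>\<sigma>=0..\<alpha>. LINT x|lebesgue. cmod (?g \<sigma> x) powr p * ?r \<sigma> x"
  have "integral\<^sup>L lebesgue (energy F) = (\<Sum>\<sigma>\<le>\<alpha>. integral\<^sup>L lebesgue (?t \<sigma>))"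
    unfolding energy_def[abs_def] by (intro Bochner_Integration.integral_sum t_int) simp
  also have "\<dots> = ?S"
    by (rule sum.cong) (auto simp: atLeast0AtMost t_eq)
  also have "?S = (?S powr (1 / p)) powr p"
  proof -
    have "?S \<ge> 0" by (intro sum_nonneg integral_nonneg_AE AE_I2) (simp add: rho_def)
    then show ?thesis using p by (simp add: powr_powr)
  qed
  finally have "integral\<^sup>L lebesgue (energy F) \<le> var_sobolev_norm q m \<alpha> p sobolev_weight_exponent f powr p"
    by (simp add: var_sobolev_norm_def)
  moreover have "AE x in lebesgue. F 0 x = f x"
    using AE[of 0] has_weak_deriv_0_AE[OF g[of 0]] by auto
  ultimately show ?thesis using that ac E by (auto simp: sobolev_chain_def)
qed

text \<open>\<open>transform F 0\<close> carries one factor \<open>jac\<close>. In the integral it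
  is cancelled by \<open>1 / jac\<close>; at a node it is the derivative of
  \<open>phi\<close>.\<close>

lemma quadrature_error_transform:
  assumes F: "sobolev_chain F" and f: "AE x in lebesgue. F 0 x = f x" and n: "n \<ge> 1"
  shows "weighted_integral q m \<upsilon> f - moebius_trapezoidal q m \<gamma> \<upsilon> n (continuous_rep f) =
    (LINT x|lebesgue. (1 / jac x) *\<^sub>R transform F 0 x) -
      of_real (2 * pi / real n) * (\<Sum>j=1..n. transform F 0 (phi \<gamma> (node n j)))"
proof -
  have T: "transform F 0 x = F 0 x * of_real (rho q m \<upsilon> x * jac x)" for x
    by (simp add: transform_def weight_0_0 scaleR_conv_of_real mult_ac)
  have ac: "has_ac_deriv (F 0) (F (Suc 0))"
    using F alpha by (simp add: sobolev_chain_def)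
  have cont: "continuous_on UNIV (F 0)" by (rule has_ac_deriv_continuous[OF ac])
  have rep: "continuous_rep f = F 0" by (rule continuous_rep_eq[OF cont f])
  have "(1 / jac x) *\<^sub>R transform F 0 x = F 0 x * of_real (rho q m \<upsilon> x)" for x
    using jac_pos[of x] by (simp add: T scaleR_conv_of_real)
  moreover have "weighted_integral q m \<upsilon> f = (LINT x|lebesgue. F 0 x * of_real (rho q m \<upsilon> x))"
  proof -
    have eq: "AE x in lebesgue. F 0 x * of_real (rho q m \<upsilon> x) = f x * of_real (rho q m \<upsilon> x)"
      using f by eventually_elim simp
    have m1: "(\<lambda>x. F 0 x * complex_of_real (rho q m \<upsilon> x)) \<in> borel_measurable lebesgue"
      by (intro continuous_imp_lebesgue_measurable continuous_intros cont continuous_rho)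
    show ?thesis
      unfolding weighted_integral_def
      by (rule integral_cong_AE[OF m1 borel_measurable_AE[OF m1 eq] eq, symmetric])
  qed
  moreover have "moebius_trapezoidal q m \<gamma> \<upsilon> n (F 0) =
      of_real (2 * pi / real n) * (\<Sum>j=1..n. transform F 0 (phi \<gamma> (node n j)))"
    unfolding moebius_trapezoidal_def
  proof (intro arg_cong2[of _ _ _ _ "(*)"] refl sum.cong)
    fix j assume j: "j \<in> {1..n}"
    show "F 0 (phi \<gamma> (node n j)) * of_real (rho q m \<upsilon> (phi \<gamma> (node n j)) * deriv (phi \<gamma>) (node n j)) =
        transform F 0 (phi \<gamma> (node n j))"
      by (simp add: T angle_phi(2)[OF node_bounds[OF j]])
  qed
  ultimately show ?thesis by (simp add: rep)
qed

lemma error_bound: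
  "\<exists>C>0. \<forall>f \<in> var_sobolev q m \<alpha> p sobolev_weight_exponent. \<forall>n\<ge>1.
    cmod (weighted_integral q m \<upsilon> f - moebius_trapezoidal q m \<gamma> \<upsilon> n (continuous_rep f))
      \<le> C * real n powr (- real \<alpha>) * var_sobolev_norm q m \<alpha> p sobolev_weight_exponent f"
proof -
  obtain C where C: "C > 0" "\<And>F n l. sobolev_chain F \<Longrightarrow> n \<ge> 1 \<Longrightarrow> l > 0 \<Longrightarrow>
      integral\<^sup>L lebesgue (energy F) \<le> l powr p \<Longrightarrow>
      norm ((LINT x|lebesgue. (1 / jac x) *\<^sub>R transform F 0 x) -
        of_real (2 * pi / real n) * (\<Sum>j=1..n. transform F 0 (phi \<gamma> (node n j))))
      \<le> C * real n powr (- real \<alpha>) * l"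
    using quadrature_error_le by blast
  show ?thesis
  proof (intro exI[of _ C] conjI C(1) ballI allI impI)
    fix f and n :: nat
    assume f: "f \<in> var_sobolev q m \<alpha> p sobolev_weight_exponent" and n: "n \<ge> 1"
    let ?N = "var_sobolev_norm q m \<alpha> p sobolev_weight_exponent f"
    let ?e = "cmod (weighted_integral q m \<upsilon> f - moebius_trapezoidal q m \<gamma> \<upsilon> n (continuous_rep f))"
    obtain F where F: "sobolev_chain F" "AE x in lebesgue. F 0 x = f x"
      "integral\<^sup>L lebesgue (energy F) \<le> ?N powr p"
      using sobolev_chain_of_weak_derivs[OF f] by blast
    have N: "?N \<ge> 0" by (simp add: var_sobolev_norm_def)
    define c where "c = C * real n powr (- real \<alpha>)"
    have c: "c > 0" using C(1) n by (simp add: c_def)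
    have "?e \<le> c * ?N"
    \<comment> \<open>The norm may be 0, whereas the scale \<open>l\<close> must be positive. So the
      norm is enlarged by e/c, which adds e to the bound, and e is arbitrary.\<close>
    proof (rule field_le_epsilon)
      fix e :: real assume e: "e > 0"
      define l where "l = ?N + e / c"
      have "e / c > 0" using e c by (rule divide_pos_pos)
      then have l: "l > 0" "?N \<le> l" using N by (auto simp: l_def)
      have "integral\<^sup>L lebesgue (energy F) \<le> l powr p"
        using F(3) by (rule order_trans) (use N l p in \<open>intro powr_mono2; simp\<close>)
      then have "?e \<le> c * l"
        unfolding quadrature_error_transform[OF F(1,2) n] c_def by (intro C(2) F n l)
      also have "c * l = c * ?N + e"
        unfolding l_def distrib_left using c by simp
      finally show "?e \<le> c * ?N + e" .
    qed
    then show "?e \<le> C * real n powr (- real \<alpha>) * ?N" by (simp only: c_def)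
  qed
qed

end

theorem theorem3p1:
  fixes q :: "real poly" and m :: nat and \<gamma> \<upsilon> p :: real and \<alpha> :: nat
  assumes "m \<ge> 1" and "degree q = 2 * m" and "\<forall>x. poly q x > 0"
    and "\<gamma> > 0" and "1 < p" and "\<alpha> \<ge> 1"
  shows "\<exists>C>0. \<forall>f \<in> var_sobolev q m \<alpha> p (p * (\<upsilon> - 2 - 2 * real \<alpha>) + 2). \<forall>n\<ge>1.
    cmod (weighted_integral q m \<upsilon> f - moebius_trapezoidal q m \<gamma> \<upsilon> n (continuous_rep f))
      \<le> C * real n powr (- real \<alpha>) *
         var_sobolev_norm q m \<alpha> p (p * (\<upsilon> - 2 - 2 * real \<alpha>) + 2) f"
proof -
  interpret moebius_rule q m \<gamma> \<upsilon> p \<alpha>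
    by unfold_locales (use assms in auto)
  show ?thesis by (rule error_bound)
qed

end
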